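(* Let $D \subseteq \mathbb{C}$ be a domain, $C>0$, and let $\mathcal{F}$ be a family of functions meromorphic on $D$ such that $$\frac{1}{\pi}\int_{D} \big(f^{\sharp}(z)\big)^2\,dx\,dy\le C \qquad \text{for all } f\in\mathcal{F}.$$ Then $\mathcal{F}$ is quasi-normal of order at most $C$.
   Context: For a meromorphic function $f$, the spherical derivative is $f^{\sharp}(z) := \dfrac{|f'(z)|}{1+|f(z)|^2}$, extended continuously to the poles of $f$. A family $\mathcal{F}$ of meromorphic functions on a domain $D$ is called quasi-normal if every sequence in $\mathcal{F}$ has a subsequence which converges locally uniformly with respect to the spherical metric on $D\setminus S$, where the set $S\subseteq D$ (which may depend on the extracted subsequence) has no accumulation point in $D$; the limit function is meromorphic on $D \setminus S$ or identically $\infty$. If the subsequence can always be chosen such that $S$ has at most $\nu\ge 0$ points, then $\mathcal{F}$ is said to be quasi-normal of order at most $\nu$. The spherical metric is the metric on $\hat{\mathbb{C}}=\mathbb{C}\cup\{\infty\}$ induced by $|dw|/(1+|w|^2)$. *)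

theory Defs
  imports "HOL-Complex_Analysis.Complex_Analysis"
begin

text \<open>
  The extended plane is the one-point compactification
  \<^term>\<open>Alexandroff_compactification euclidean\<close> of the complex plane, with \<^term>\<open>None\<close> as the point at infinity.

  A local coordinate around the point \<open>p\<close>: the identity if \<open>p\<close> is finite, and \<open>1/w\<close> if \<open>p\<close> is
  infinity. The value at the one point outside the domain of the coordinate (infinity, respectively
  zero) is a dummy; a coordinate is only ever used near \<open>p\<close>.
\<close>

definition sph_coord :: "complex option \<Rightarrow> complex option \<Rightarrow> complex" where
  "sph_coord p q =
     (case p of
        Some _ \<Rightarrow> (case q of Some w \<Rightarrow> w | None \<Rightarrow> 0)
      | None \<Rightarrow> (case q of Some w \<Rightarrow> inverse w | None \<Rightarrow> 0))"

definition sph_path :: "(real \<Rightarrow> complex option) \<Rightarrow> bool" where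
  "sph_path \<gamma> \<longleftrightarrow>
     pathin (Alexandroff_compactification euclidean) \<gamma> \<and>
     (\<exists>T. finite T \<and>
        (\<forall>t\<in>{0<..<1} - T. \<exists>e>0. (sph_coord (\<gamma> t) \<circ> \<gamma>) C1_differentiable_on ball t e))"

text \<open>
  The speed of a path with respect to \<open>|dw| / (1 + |w|\<^sup>2)\<close>. This form is invariant under
  \<open>w \<mapsto> 1/w\<close>, so it has the same expression in both coordinates.
\<close>

definition sph_speed :: "(real \<Rightarrow> complex option) \<Rightarrow> real \<Rightarrow> real" where
  "sph_speed \<gamma> t =
     norm (vector_derivative (sph_coord (\<gamma> t) \<circ> \<gamma>) (at t)) /
     (1 + (norm (sph_coord (\<gamma> t) (\<gamma> t)))\<^sup>2)"

definition sph_length :: "(real \<Rightarrow> complex option) \<Rightarrow> ennreal" where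
  "sph_length \<gamma> = (\<integral>\<^sup>+ t\<in>{0..1}. ennreal (sph_speed \<gamma> t) \<partial>lborel)"

definition sph_dist :: "complex option \<Rightarrow> complex option \<Rightarrow> ennreal" where
  "sph_dist p q = (INF \<gamma> \<in> {\<gamma>. sph_path \<gamma> \<and> \<gamma> 0 = p \<and> \<gamma> 1 = q}. sph_length \<gamma>)"

text \<open>
  A meromorphic function is represented by its normal form \<open>nicely_meromorphic_on\<close>: no removable
  singularities, and the (irrelevant) complex value 0 at poles. The following is the corresponding
  function with values in the extended plane.
\<close>

definition sph_val :: "(complex \<Rightarrow> complex) \<Rightarrow> complex \<Rightarrow> complex option" where
  "sph_val f z = (if is_pole f z then None else Some (f z))"

definition sph_deriv :: "(complex \<Rightarrow> complex) \<Rightarrow> complex \<Rightarrow> real" where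
  "sph_deriv f z =
     (if is_pole f z then Lim (at z) (\<lambda>w. norm (deriv f w) / (1 + (norm (f w))\<^sup>2))
      else norm (deriv f z) / (1 + (norm (f z))\<^sup>2))"

definition sph_locally_uniform_limit ::
    "complex set \<Rightarrow> (nat \<Rightarrow> complex \<Rightarrow> complex option) \<Rightarrow> (complex \<Rightarrow> complex option) \<Rightarrow> bool" where
  "sph_locally_uniform_limit U f g \<longleftrightarrow>
     (\<forall>z\<in>U. \<exists>r>0. \<forall>\<epsilon>>0. \<forall>\<^sub>F n in sequentially.
        \<forall>w\<in>ball z r \<inter> U. sph_dist (f n w) (g w) < ennreal \<epsilon>)"

definition sph_convergent_on :: "complex set \<Rightarrow> (nat \<Rightarrow> complex \<Rightarrow> complex) \<Rightarrow> bool" where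
  "sph_convergent_on U f \<longleftrightarrow>
     (\<exists>g. g nicely_meromorphic_on U \<and>
        sph_locally_uniform_limit U (\<lambda>n. sph_val (f n)) (sph_val g)) \<or>
     sph_locally_uniform_limit U (\<lambda>n. sph_val (f n)) (\<lambda>_. None)"

text \<open>
  The exceptional set \<open>S\<close> has at most \<open>\<nu>\<close> points, so it is finite and the condition that it has no
  accumulation point in \<open>D\<close> is automatic; it is kept because it is part of quasi-normality.
\<close>

definition quasi_normal_of_order :: "complex set \<Rightarrow> (complex \<Rightarrow> complex) set \<Rightarrow> real \<Rightarrow> bool" where
  "quasi_normal_of_order D \<F> \<nu> \<longleftrightarrow>
     (\<forall>f::nat \<Rightarrow> complex \<Rightarrow> complex. range f \<subseteq> \<F> \<longrightarrow>
        (\<exists>r S. strict_mono r \<and> S \<subseteq> D \<and> (\<forall>z\<in>D. \<not> z islimpt S) \<and>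
           finite S \<and> real (card S) \<le> \<nu> \<and> sph_convergent_on (D - S) (f \<circ> r)))"

end

theory Submission
  imports Defs "HOL-Library.Diagonal_Subsequence"
begin

text \<open>
  The map \<open>w / sqrt (1 + |w|\<^sup>2)\<close> carries the spherical area to Lebesgue measure on the unit disc, of
  total mass \<open>\<pi>\<close>. So a meromorphic function with spherical area at most \<open>\<pi> c\<close>, \<open>c < 1\<close>, on a ball
  omits a set of values of measure at least \<open>\<pi> (1 - c)\<close>, which contains three bounded and uniformly
  separated points \<open>a, b, d\<close>. The Moebius transformation taking \<open>a, b, d\<close> to \<open>0, \<infinity>, 1\<close> followed by
  Schottky's theorem bounds \<open>1 / (f - b)\<close> locally, and Montel's theorem gives a convergent
  subsequence on the ball.

  For a sequence in the family, a diagonal argument over countably many balls yields a subsequence for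
  which on each ball either convergence holds or the areas eventually exceed every \<open>\<pi> c\<close>, \<open>c < 1\<close>. The
  points all of whose ball neighbourhoods are of the second kind each absorb area \<open>\<pi>\<close>, so that there
  are at most \<open>C\<close> of them. Off these points the local limits fit together; since the complement is
  connected, the limit is either meromorphic or identically infinite.
\<close>

section \<open>Upper bounds for the spherical distance\<close>

text \<open>The inverse of the coordinate \<open>1/w\<close> at infinity, extended to the whole
  plane by sending 0 to \<open>None\<close>.\<close>

definition sph_inv :: "complex \<Rightarrow> complex option" where
  "sph_inv u = (if u = 0 then None else Some (inverse u))"

text \<open>The distance is an infimum of lengths, so a single path over the unit interval with
  bounded speed gives the bound.\<close>

lemma sph_dist_le:
  assumes "sph_path \<gamma>" "\<gamma> 0 = p" "\<gamma> 1 = q"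
    and speed: "\<And>t. t \<in> {0..1} \<Longrightarrow> sph_speed \<gamma> t \<le> c"
  shows "sph_dist p q \<le> ennreal c"
proof -
  have "sph_dist p q \<le> sph_length \<gamma>"
    unfolding sph_dist_def by (rule INF_lower) (use assms in auto)
  also have "\<dots> \<le> (\<integral>\<^sup>+ t\<in>{0..1::real}. ennreal c \<partial>lborel)"
    unfolding sph_length_def
    by (rule nn_integral_mono) (auto simp: indicator_def speed intro!: ennreal_leI)
  also have "\<dots> = ennreal c"
    by (simp add: nn_integral_cmult_indicator)
  finally show ?thesis .
qed

text \<open>The straight segment has constant Euclidean speed \<open>dist a b\<close>, and the
  spherical density is at most 1.\<close>

lemma sph_dist_Some_le: "sph_dist (Some a) (Some b) \<le> ennreal (dist a b)"
proof -
  define u where "u = (\<lambda>t::real. a + of_real t * (b - a))"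
  define \<gamma> where "\<gamma> = (\<lambda>t. Some (u t))"
  have coord: "sph_coord (\<gamma> t) \<circ> \<gamma> = u" for t
    by (auto simp: sph_coord_def \<gamma>_def)
  have der: "(u has_vector_derivative (b - a)) (at t)" for t
    unfolding u_def has_vector_derivative_def
    by (auto intro!: derivative_eq_intros simp: scaleR_conv_of_real)
  show ?thesis
  proof (rule sph_dist_le)
    have "continuous_on {0..1} u"
      unfolding u_def by (intro continuous_intros)
    then have "continuous_map (top_of_set {0..1}) euclidean u" by simp
    from continuous_map_compose[OF this continuous_map_Some]
    have "pathin (Alexandroff_compactification euclidean) \<gamma>"
      by (simp add: pathin_def \<gamma>_def o_def)
    moreover have "\<exists>e>0. u C1_differentiable_on ball t e" for t
      unfolding C1_differentiable_on_def using der
      by (intro exI[of _ 1] conjI exI[of _ "\<lambda>_. b - a"]) auto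
    ultimately show "sph_path \<gamma>"
      unfolding sph_path_def coord by (intro conjI exI[of _ "{}"]) auto
    show "sph_speed \<gamma> t \<le> dist a b" for t
    proof -
      have "vector_derivative u (at t) = b - a"
        using der by (rule vector_derivative_at)
      then show ?thesis
        unfolding sph_speed_def coord
        by (simp add: dist_norm norm_minus_commute divide_le_eq add_pos_nonneg mult_le_cancel_left1)
    qed
  qed (auto simp: \<gamma>_def u_def)
qed

lemma continuous_map_sph_inv:
  "continuous_map euclidean (Alexandroff_compactification euclidean) sph_inv"
  unfolding continuous_map_def
proof (intro conjI strip)
  show "sph_inv \<in> topspace euclidean \<rightarrow> topspace (Alexandroff_compactification euclidean)"
    by (auto simp: sph_inv_def)
  fix V :: "complex option set"
  assume V: "openin (Alexandroff_compactification euclidean) V"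
  have inv: "open {u. u \<noteq> 0 \<and> inverse u \<in> W}" if "open W" for W :: "complex set"
  proof -
    have "open ((- {0}) \<inter> inverse -` W)"
      by (rule continuous_open_preimage) (auto intro!: continuous_intros that)
    also have "(- {0}) \<inter> inverse -` W = {u. u \<noteq> 0 \<and> inverse u \<in> W}" by auto
    finally show ?thesis .
  qed
  from V consider W where "open W" "V = Some ` W"
    | K where "compact K" "V = insert None (Some ` (- K))"
    by (auto simp: openin_Alexandroff_compactification Compl_eq_Diff_UNIV)
  then have "open {u. sph_inv u \<in> V}"
  proof cases
    case 1
    then have "{u. sph_inv u \<in> V} = {u. u \<noteq> 0 \<and> inverse u \<in> W}"
      by (auto simp: sph_inv_def)
    then show ?thesis using inv 1 by simp
  next
    case 2
    obtain M where M: "M > 0" "\<And>w. w \<in> K \<Longrightarrow> norm w \<le> M"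
      using compact_imp_bounded[OF 2(1)] by (auto simp: bounded_pos)
    \<comment> \<open>The ball covers the part near 0, infinity included: there \<open>1/u\<close>
      has modulus beyond the bound \<open>M\<close> of \<open>K\<close>. The second set is open by
      \<open>inv\<close>.\<close>
    have "{u. sph_inv u \<in> V} = ball 0 (inverse M) \<union> {u. u \<noteq> 0 \<and> inverse u \<in> - K}"
    proof (intro equalityI subsetI)
      fix u assume "u \<in> ball 0 (inverse M) \<union> {u. u \<noteq> 0 \<and> inverse u \<in> - K}"
      moreover have "inverse u \<notin> K" if "u \<noteq> 0" "norm u < inverse M"
        using M that by (metis inverse_inverse_eq inverse_le_imp_le linorder_not_le
            norm_inverse zero_less_norm_iff)
      ultimately show "u \<in> {u. sph_inv u \<in> V}"
        by (auto simp: 2 sph_inv_def)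
    qed (use M in \<open>auto simp: 2 sph_inv_def split: if_splits\<close>)
    moreover have "open (- K)" using 2 compact_imp_closed by blast
    ultimately show ?thesis using inv[of "- K"] by (simp only: open_Un open_ball)
  qed
  then show "openin euclidean {u \<in> topspace euclidean. sph_inv u \<in> V}" by simp
qed

text \<open>The path is a segment in the coordinate \<open>1/w\<close>, so it may run through
  infinity. As the metric is invariant under inversion, the bound is the same as in the finite
  coordinate.\<close>

lemma sph_dist_inv_le: "sph_dist (sph_inv a) (sph_inv b) \<le> ennreal (dist a b)"
proof -
  define u where "u = (\<lambda>t::real. a + of_real t * (b - a))"
  define \<gamma> where "\<gamma> = (\<lambda>t. sph_inv (u t))"
  \<comment> \<open>At infinity the coordinate undoes the inversion and returns \<open>u\<close>; at
    a finite point the path is read as \<open>1/u\<close>.\<close>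
  have coord: "sph_coord (\<gamma> t) \<circ> \<gamma> = (if u t = 0 then u else (\<lambda>s. inverse (u s)))" for t
    by (auto simp: sph_coord_def \<gamma>_def sph_inv_def)
  have der: "(u has_vector_derivative (b - a)) (at t)" for t
    unfolding u_def has_vector_derivative_def
    by (auto intro!: derivative_eq_intros simp: scaleR_conv_of_real)
  have der_inv: "((\<lambda>s. inverse (u s)) has_vector_derivative (- ((b - a) / (u t)\<^sup>2))) (at t)"
    if "u t \<noteq> 0" for t
    using field_vector_diff_chain_at[OF der[of t] DERIV_inverse[OF that]]
    by (simp add: o_def divide_inverse power2_eq_square)
  have cont: "continuous_on UNIV u"
    unfolding u_def by (intro continuous_intros)
  show ?thesis
  proof (rule sph_dist_le)
    show "sph_path \<gamma>"
      unfolding sph_path_def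
    proof (intro conjI exI[of _ "{}"] ballI)
      have "continuous_map (top_of_set {0..1}) euclidean u"
        using continuous_on_subset[OF cont] by simp
      from continuous_map_compose[OF this continuous_map_sph_inv]
      show "pathin (Alexandroff_compactification euclidean) \<gamma>"
        by (simp add: pathin_def \<gamma>_def o_def)
    next
      fix t
      show "\<exists>e>0. (sph_coord (\<gamma> t) \<circ> \<gamma>) C1_differentiable_on ball t e"
      proof (cases "u t = 0")
        case True
        then show ?thesis
          unfolding coord C1_differentiable_on_def using der
          by (intro exI[of _ 1] conjI exI[of _ "\<lambda>_. b - a"]) auto
      next
        case False
        have "open (u -` (- {0}))"
          by (rule open_vimage[OF _ cont]) auto
        then obtain e where "e > 0" and e: "ball t e \<subseteq> u -` (- {0})"
          using False by (metis ComplI openE singletonD vimageI)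
        have "(\<lambda>s. inverse (u s)) C1_differentiable_on ball t e"
          unfolding C1_differentiable_on_def
        proof (intro exI conjI ballI)
          show "((\<lambda>s. inverse (u s)) has_vector_derivative (- ((b - a) / (u s)\<^sup>2))) (at s)"
            if "s \<in> ball t e" for s
            using e that by (intro der_inv) auto
          show "continuous_on (ball t e) (\<lambda>s. - ((b - a) / (u s)\<^sup>2))"
            using e by (intro continuous_intros continuous_on_subset[OF cont]) auto
        qed
        then show ?thesis using False \<open>e > 0\<close> unfolding coord by auto
      qed
    qed auto
    show "sph_speed \<gamma> t \<le> dist a b" for t
    proof (cases "u t = 0")
      case True
      have "vector_derivative u (at t) = b - a"
        using der by (rule vector_derivative_at)
      moreover have "sph_coord (\<gamma> t) (\<gamma> t) = 0"
        using True by (simp add: sph_coord_def \<gamma>_def sph_inv_def)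
      ultimately show ?thesis
        unfolding sph_speed_def coord by (simp add: True dist_norm norm_minus_commute)
    next
      case False
      have "vector_derivative (\<lambda>s. inverse (u s)) (at t) = - ((b - a) / (u t)\<^sup>2)"
        using der_inv[OF False] by (rule vector_derivative_at)
      moreover have "sph_coord (\<gamma> t) (\<gamma> t) = inverse (u t)"
        using False by (simp add: sph_coord_def \<gamma>_def sph_inv_def)
      ultimately have "sph_speed \<gamma> t = norm (b - a) / (norm (u t))\<^sup>2 / (1 + (inverse (norm (u t)))\<^sup>2)"
        unfolding sph_speed_def coord
        by (simp add: False norm_divide norm_power norm_inverse)
      also have "\<dots> = norm (b - a) / ((norm (u t))\<^sup>2 + 1)"
        using False by (simp add: field_simps)
      also have "\<dots> \<le> dist a b"
        by (simp add: dist_norm norm_minus_commute divide_le_eq add_pos_nonneg add_nonneg_pos mult_le_cancel_left1)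
      finally show ?thesis .
    qed
  qed (auto simp: \<gamma>_def u_def)
qed

section \<open>Values omitted by functions of small spherical area\<close>

definition complex_of_vec :: "real^2 \<Rightarrow> complex" where
  "complex_of_vec v = Complex (v $ 1) (v $ 2)"

definition vec_of_complex :: "complex \<Rightarrow> real^2" where
  "vec_of_complex z = vector [Re z, Im z]"

lemma complex_of_vec_inverse [simp]: "vec_of_complex (complex_of_vec v) = v"
  by (simp add: vec_of_complex_def complex_of_vec_def vec_eq_iff forall_2)

lemma vec_of_complex_inverse [simp]: "complex_of_vec (vec_of_complex z) = z"
  by (simp add: vec_of_complex_def complex_of_vec_def)

lemma linear_complex_of_vec: "linear complex_of_vec"
  by (rule linearI) (auto simp: complex_of_vec_def complex_eq_iff)

lemma linear_vec_of_complex: "linear vec_of_complex"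
  by (rule linearI) (auto simp: vec_of_complex_def vec_eq_iff forall_2)

lemma continuous_on_complex_of_vec [continuous_intros]:
  "continuous_on S g \<Longrightarrow> continuous_on S (\<lambda>x. complex_of_vec (g x))"
  by (rule bounded_linear.continuous_on[OF linear_linear[THEN iffD2, OF linear_complex_of_vec]])

lemma continuous_on_vec_of_complex [continuous_intros]:
  "continuous_on S g \<Longrightarrow> continuous_on S (\<lambda>x. vec_of_complex (g x))"
  by (rule bounded_linear.continuous_on[OF linear_linear[THEN iffD2, OF linear_vec_of_complex]])

lemma measurable_complex_of_vec [measurable]: "complex_of_vec \<in> borel_measurable borel"
  by (intro borel_measurable_continuous_onI linear_continuous_on linear_linear[THEN iffD2] linear_complex_of_vec)

lemma Basis_real_2: "(Basis :: (real^2) set) = {axis 1 1, axis 2 1}"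
  by (auto simp: Basis_vec_def UNIV_2)

lemma lborel_complex_eq_distr: "(lborel :: complex measure) = distr lborel borel complex_of_vec"
proof (rule lborel_eqI)
  fix l u :: complex
  assume le: "\<And>b. b \<in> Basis \<Longrightarrow> l \<bullet> b \<le> u \<bullet> b"
  have le': "Re l \<le> Re u" "Im l \<le> Im u"
    using le[of 1] le[of \<i>] by (auto simp: Basis_complex_def)
  have "complex_of_vec -` box l u = box (vec_of_complex l) (vec_of_complex u)"
    by (auto simp: in_box_complex_iff mem_box_cart forall_2 complex_of_vec_def vec_of_complex_def)
  then have "emeasure (distr lborel borel complex_of_vec) (box l u)
      = emeasure lborel (box (vec_of_complex l) (vec_of_complex u))"
    by (simp add: emeasure_distr)
  also have "\<dots> = (\<Prod>b\<in>Basis. (vec_of_complex u - vec_of_complex l) \<bullet> b)"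
    using le' by (subst emeasure_lborel_box)
      (auto simp: Basis_real_2 inner_axis vec_of_complex_def)
  also have "\<dots> = (\<Prod>b\<in>Basis. (u - l) \<bullet> b)"
    by (simp add: Basis_real_2 Basis_complex_def inner_axis vec_of_complex_def axis_eq_axis)
  finally show "emeasure (distr lborel borel complex_of_vec) (box l u) = (\<Prod>b\<in>Basis. (u - l) \<bullet> b)" .
qed simp

text \<open>
  The change of variables inequality of the library is only available on \<open>real^'n\<close>; the image is
  enclosed in an open set so that no measurability of images has to be transferred.
\<close>

lemma image_subset_open_measure_le:
  fixes f :: "complex \<Rightarrow> complex" and f' :: "complex \<Rightarrow> complex \<Rightarrow> complex"
  assumes "open V" and der: "\<And>z. z \<in> V \<Longrightarrow> (f has_derivative f' z) (at z)"
    and J: "\<And>z. z \<in> V \<Longrightarrow> \<bar>Re (f' z 1) * Im (f' z \<i>) - Im (f' z 1) * Re (f' z \<i>)\<bar> = J z"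
    and contJ: "continuous_on V J"
    and int: "(\<integral>\<^sup>+ z\<in>V. ennreal (J z) \<partial>lborel) \<le> ennreal c" and "0 \<le> c" "c < d"
  obtains T where "open T" "f ` V \<subseteq> T" "emeasure lborel T \<le> ennreal d"
proof -
  define W where "W = complex_of_vec -` V"
  define g where "g = (\<lambda>v. vec_of_complex (f (complex_of_vec v)))"
  define g' where "g' = (\<lambda>v h. vec_of_complex (f' (complex_of_vec v) (complex_of_vec h)))"
  have "open W"
    unfolding W_def by (rule open_vimage[OF \<open>open V\<close>]) (intro continuous_intros)
  have derg: "(g has_derivative g' v) (at v within W)" if "v \<in> W" for v
  proof -
    have "(complex_of_vec has_derivative complex_of_vec) (at v)"
      "(vec_of_complex has_derivative vec_of_complex) (at (f (complex_of_vec v)))"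
      using linear_complex_of_vec linear_vec_of_complex
      by (auto intro!: linear_imp_has_derivative)
    moreover have "(f has_derivative f' (complex_of_vec v)) (at (complex_of_vec v))"
      using that by (intro der) (auto simp: W_def)
    ultimately have "(vec_of_complex \<circ> (f \<circ> complex_of_vec) has_derivative
        vec_of_complex \<circ> (f' (complex_of_vec v) \<circ> complex_of_vec)) (at v)"
      by (auto intro!: diff_chain_at)
    then show ?thesis
      by (auto simp: g_def g'_def o_def intro: has_derivative_at_withinI)
  qed
  have det: "\<bar>det (matrix (g' v))\<bar> = J (complex_of_vec v)" if "v \<in> W" for v
  proof -
    have "complex_of_vec (axis 1 1) = 1" "complex_of_vec (axis 2 1) = \<i>"
      by (auto simp: complex_of_vec_def complex_eq_iff axis_def)
    then show ?thesis
      using J[of "complex_of_vec v"] that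
      by (simp add: det_2 matrix_def g'_def W_def vec_of_complex_def algebra_simps)
  qed
  have J0: "0 \<le> J z" if "z \<in> V" for z
    using J[OF that] by (metis abs_ge_zero)
  have contJ': "continuous_on W (\<lambda>v. J (complex_of_vec v))"
    by (rule continuous_on_compose2[OF contJ]) (auto simp: W_def intro!: continuous_intros)
  have "(\<lambda>z. ennreal (J z) * indicator V z) \<in> borel_measurable borel"
  proof -
    have "(\<lambda>z. indicator V z *\<^sub>R J z) \<in> borel_measurable borel"
      by (rule borel_measurable_continuous_on_indicator[OF _ contJ]) (simp add: \<open>open V\<close>)
    then have "(\<lambda>z. ennreal (indicator V z *\<^sub>R J z)) \<in> borel_measurable borel" by measurable
    also have "(\<lambda>z. ennreal (indicator V z *\<^sub>R J z)) = (\<lambda>z. ennreal (J z) * indicator V z)"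
      by (auto simp: indicator_def)
    finally show ?thesis .
  qed
  then have "(\<integral>\<^sup>+ z\<in>V. ennreal (J z) \<partial>lborel)
      = (\<integral>\<^sup>+ v\<in>W. ennreal (J (complex_of_vec v)) \<partial>lborel)"
    by (subst lborel_complex_eq_distr, subst nn_integral_distr) (auto simp: W_def indicator_def)
  then have int': "(\<integral>\<^sup>+ v\<in>W. ennreal (J (complex_of_vec v)) \<partial>lborel) \<le> ennreal c"
    using int by simp
  have bm: "set_borel_measurable borel W (\<lambda>v. J (complex_of_vec v))"
    using borel_measurable_continuous_on_indicator[OF _ contJ'] \<open>open W\<close>
    by (simp add: set_borel_measurable_def)
  have fin: "(\<integral>\<^sup>+ v\<in>W. ennreal (J (complex_of_vec v)) \<partial>lborel) < \<infinity>"
    using int' by (rule order.strict_trans1) simp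
  have integrable: "(\<lambda>v. J (complex_of_vec v)) integrable_on W"
  proof -
    have eq: "(\<lambda>v. ennreal (J (complex_of_vec v)) * indicator W v)
        = (\<lambda>v. ennreal (indicator W v *\<^sub>R J (complex_of_vec v)))"
      by (auto simp: indicator_def)
    have "(\<lambda>v. indicator W v *\<^sub>R J (complex_of_vec v)) integrable_on UNIV"
      using bm fin unfolding eq set_borel_measurable_def
      by (intro nn_integral_integrable_on) (auto simp: indicator_def J0 W_def)
    also have "(\<lambda>v. indicator W v *\<^sub>R J (complex_of_vec v))
        = (\<lambda>v. if v \<in> W then J (complex_of_vec v) else 0)"
      by (auto simp: indicator_def)
    finally show ?thesis
      by (simp only: integrable_restrict_UNIV)
  qed
  have eqI: "(\<integral>\<^sup>+ v\<in>W. ennreal (J (complex_of_vec v)) \<partial>lborel) = integral W (\<lambda>v. J (complex_of_vec v))"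
    by (rule set_nn_integral_lborel_eq_integral[OF bm _ fin]) (auto simp: W_def J0)
  have integrable': "(\<lambda>v. \<bar>det (matrix (g' v))\<bar>) integrable_on W"
    using integrable by (rule integrable_eq) (simp add: det)
  have W: "W \<in> sets lebesgue"
    using \<open>open W\<close> by auto
  have gW: "g ` W \<in> lmeasurable"
    by (rule measurable_differentiable_image[OF W derg integrable'])
  have "measure lebesgue (g ` W) \<le> integral W (\<lambda>v. \<bar>det (matrix (g' v))\<bar>)"
    by (rule measure_differentiable_image[OF W derg integrable'])
  also have "\<dots> = integral W (\<lambda>v. J (complex_of_vec v))"
    by (rule integral_cong) (simp add: det)
  finally have "emeasure lebesgue (g ` W) \<le> ennreal c"
    using gW int' unfolding eqI
    by (simp add: emeasure_eq_measure2) (meson ennreal_leI order_trans)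
  \<comment> \<open>Outer regularity: the gap between \<open>c\<close> and \<open>d\<close> pays for
    enlarging the image to an open set.\<close>
  obtain T where T: "open T" "g ` W \<subseteq> T" "T - g ` W \<in> lmeasurable"
      "emeasure lebesgue (T - g ` W) < ennreal (d - c)"
    by (rule sets_lebesgue_outer_open[of "g ` W" "d - c"]) (use gW \<open>c < d\<close> in auto)
  have "emeasure lebesgue T = emeasure lebesgue (g ` W) + emeasure lebesgue (T - g ` W)"
    using T gW by (subst plus_emeasure) (auto simp: Un_absorb1)
  also have "\<dots> \<le> ennreal c + ennreal (d - c)"
    using T \<open>emeasure lebesgue (g ` W) \<le> ennreal c\<close> by (intro add_mono) auto
  also have "\<dots> = ennreal d"
    using \<open>c < d\<close> \<open>0 \<le> c\<close> by (simp flip: ennreal_plus)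
  finally have "emeasure lborel T \<le> ennreal d"
    using T(1) by simp
  show thesis
  proof
    show "open (vec_of_complex -` T)"
      by (rule open_vimage[OF T(1)]) (intro continuous_intros)
    show "f ` V \<subseteq> vec_of_complex -` T"
    proof safe
      fix z assume "z \<in> V"
      then have "vec_of_complex z \<in> W" by (simp add: W_def)
      then have "g (vec_of_complex z) \<in> T" using T by blast
      then show "f z \<in> vec_of_complex -` T" by (simp add: g_def)
    qed
    then show "emeasure lborel (vec_of_complex -` T) \<le> ennreal d"
      using \<open>emeasure lborel T \<le> ennreal d\<close> T(1) \<open>open (vec_of_complex -` T)\<close>
      by (subst lborel_complex_eq_distr, subst emeasure_distr) (auto simp: vimage_def)
  qed
qed

text \<open>Its Jacobian is \<open>1 / (1 + |w|\<^sup>2)\<^sup>2\<close>, the density of the spherical area.\<close>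

definition sph_disc :: "complex \<Rightarrow> complex" where
  "sph_disc w = w /\<^sub>R sqrt (1 + w \<bullet> w)"

lemma has_derivative_sph_disc:
  fixes w :: complex
  defines "s \<equiv> sqrt (1 + w \<bullet> w)"
  shows "(sph_disc has_derivative (\<lambda>v. v /\<^sub>R s - ((w \<bullet> v) / s ^ 3) *\<^sub>R w)) (at w)"
proof -
  have s: "s > 0" "1 + w \<bullet> w = s\<^sup>2" "sqrt (s\<^sup>2) = s"
    by (simp_all add: s_def add_pos_nonneg)
  have inner: "((\<lambda>w. 1 + w \<bullet> w) has_derivative (\<lambda>h. 2 * (w \<bullet> h))) (at w)"
    by (auto intro!: derivative_eq_intros simp: inner_commute)
  have outer: "((\<lambda>x. inverse (sqrt x)) has_real_derivative - (inverse (s ^ 3) / 2)) (at (1 + w \<bullet> w))"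
    unfolding s(2) using s(1,3)
    by (auto intro!: derivative_eq_intros simp: field_simps power2_eq_square power3_eq_cube)
  have "((\<lambda>w. inverse (sqrt (1 + w \<bullet> w))) has_derivative
      (\<lambda>h. 2 * (w \<bullet> h) * - (inverse (s ^ 3) / 2))) (at w)"
    by (rule DERIV_compose_FDERIV[where g = "\<lambda>w. 1 + w \<bullet> w", OF outer inner])
  from has_derivative_scaleR[OF this has_derivative_ident]
  have D: "((\<lambda>w. inverse (sqrt (1 + w \<bullet> w)) *\<^sub>R w) has_derivative
      (\<lambda>h. inverse s *\<^sub>R h + (2 * (w \<bullet> h) * - (inverse (s ^ 3) / 2)) *\<^sub>R w)) (at w)"
    unfolding s_def .
  have "(\<lambda>h. inverse s *\<^sub>R h + (2 * (w \<bullet> h) * - (inverse (s ^ 3) / 2)) *\<^sub>R w)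
      = (\<lambda>v. v /\<^sub>R s - ((w \<bullet> v) / s ^ 3) *\<^sub>R w)"
  proof
    fix h
    have "2 * (w \<bullet> h) * - (inverse (s ^ 3) / 2) = - ((w \<bullet> h) / s ^ 3)"
      using s(1) by (simp only: field_simps) simp
    then show "inverse s *\<^sub>R h + (2 * (w \<bullet> h) * - (inverse (s ^ 3) / 2)) *\<^sub>R w
        = h /\<^sub>R s - ((w \<bullet> h) / s ^ 3) *\<^sub>R w"
      by (simp only: scaleR_minus_left add_uminus_conv_diff)
  qed
  with D show ?thesis
    unfolding sph_disc_def[abs_def] by (rule has_derivative_eq_rhs)
qed

text \<open>\<open>F\<close> is the real derivative of \<open>sph_disc\<close> composed with a
  holomorphic function of value \<open>w\<close> and derivative \<open>a\<close>. Multiplication by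
  \<open>a\<close> contributes the square of its modulus; the derivative of \<open>sph_disc\<close>
  has eigenvalue \<open>1/s\<close> orthogonally to \<open>w\<close> and \<open>1/s^3\<close> along
  \<open>w\<close>, hence determinant \<open>1/s^4\<close>.\<close>

lemma sph_disc_jacobian:
  fixes w a :: complex and s :: real
  assumes "s > 0" "1 + w \<bullet> w = s\<^sup>2"
  defines "F \<equiv> \<lambda>h. (a * h) /\<^sub>R s - ((w \<bullet> (a * h)) / s ^ 3) *\<^sub>R w"
  shows "\<bar>Re (F 1) * Im (F \<i>) - Im (F 1) * Re (F \<i>)\<bar> = (norm a / (1 + (norm w)\<^sup>2))\<^sup>2"
proof -
  \<comment> \<open>Writing \<open>t\<close> for \<open>1/s\<close> turns the determinant formula
    below into a polynomial identity.\<close>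
  define t where "t = 1 / s"
  have t: "inverse s = t" "b / s ^ n = b * t ^ n" for b n
    using assms by (auto simp: t_def field_simps)
  have w: "(Re w)\<^sup>2 + (Im w)\<^sup>2 = s\<^sup>2 - 1"
    using assms by (simp add: inner_complex_def power2_eq_square)
  have "Re (F 1) * Im (F \<i>) - Im (F 1) * Re (F \<i>)
      = ((Re a)\<^sup>2 + (Im a)\<^sup>2) * (1 / s\<^sup>2 - ((Re w)\<^sup>2 + (Im w)\<^sup>2) / s ^ 4)"
    unfolding F_def by (simp add: inner_complex_def t) algebra
  also have "\<dots> = ((Re a)\<^sup>2 + (Im a)\<^sup>2) * (1 / s ^ 4)"
    unfolding w using assms(1) by (simp add: field_simps flip: power_add)
  also have "\<dots> = (norm a / (1 + (norm w)\<^sup>2))\<^sup>2"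
    using assms(2) by (simp add: cmod_power2 power_divide dot_square_norm flip: power_mult)
  finally show ?thesis by simp
qed

text \<open>The inverse map is \<open>p / sqrt (1 - |p|^2)\<close>, whose modulus increases with
  that of \<open>p\<close>. Points of a smaller disc therefore have uniformly bounded
  preimages.\<close>

lemma sph_disc_surj:
  assumes "norm p \<le> r" "r < 1"
  obtains w where "sph_disc w = p" "norm w \<le> r / sqrt (1 - r\<^sup>2)"
proof
  define w where "w = p /\<^sub>R sqrt (1 - p \<bullet> p)"
  have pp: "p \<bullet> p < 1"
    using assms by (simp add: dot_square_norm power_less_one_iff)
  have "w \<bullet> w = (p \<bullet> p) / (1 - p \<bullet> p)"
    using pp by (simp add: w_def field_simps)
  then have "1 + w \<bullet> w = inverse (1 - p \<bullet> p)"
    using pp by (simp add: field_simps)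
  then show "sph_disc w = p"
    using pp by (simp add: sph_disc_def w_def real_sqrt_inverse)
  have "norm w = norm p / sqrt (1 - (norm p)\<^sup>2)"
    using pp by (simp add: w_def divide_inverse mult.commute dot_square_norm)
  also have "\<dots> \<le> r / sqrt (1 - r\<^sup>2)"
  proof (rule frac_le)
    have "0 \<le> r" using assms norm_ge_zero order_trans by blast
    then show "0 \<le> r" "0 < sqrt (1 - r\<^sup>2)"
      using assms by (auto simp: power_less_one_iff)
    show "sqrt (1 - r\<^sup>2) \<le> sqrt (1 - (norm p)\<^sup>2)"
      using assms by (simp add: power_mono)
  qed fact
  finally show "norm w \<le> r / sqrt (1 - r\<^sup>2)" .
qed

text \<open>Area count: \<open>T\<close> and two discs of radius \<delta> have total area less than
  the disc of radius \<open>r\<close>, so they cannot cover it.\<close>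

lemma exists_far_point_outside:
  fixes T :: "complex set"
  assumes "open T" "emeasure lborel T \<le> ennreal (pi * c)" "0 \<le> c" "c + 2 * \<delta>\<^sup>2 < r\<^sup>2" "0 < \<delta>" "0 < r"
  obtains x where "norm x \<le> r" "x \<notin> T" "\<delta> \<le> dist p x" "\<delta> \<le> dist q x"
proof (cases "cball 0 r \<subseteq> T \<union> ball p \<delta> \<union> ball q \<delta>")
  case True
  have vol: "emeasure lborel (ball x \<delta>) = ennreal (pi * \<delta>\<^sup>2)" for x :: complex
    using assms by (simp add: emeasure_ball unit_ball_vol_2)
  have "ennreal (pi * r\<^sup>2) = emeasure lborel (cball (0::complex) r)"
    using assms by (simp add: emeasure_cball unit_ball_vol_2)
  also have "\<dots> \<le> emeasure lborel (T \<union> ball p \<delta> \<union> ball q \<delta>)"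
    using assms True by (intro emeasure_mono) auto
  also have "\<dots> \<le> emeasure lborel T + emeasure lborel (ball p \<delta>) + emeasure lborel (ball q \<delta>)"
    using assms by (intro order_trans[OF emeasure_subadditive] add_mono emeasure_subadditive) auto
  also have "\<dots> \<le> ennreal (pi * c) + ennreal (pi * \<delta>\<^sup>2) + ennreal (pi * \<delta>\<^sup>2)"
    unfolding vol by (intro add_mono assms order_refl)
  also have "\<dots> = ennreal (pi * (c + 2 * \<delta>\<^sup>2))"
    using assms by (simp add: algebra_simps flip: ennreal_plus)
  finally have "pi * r\<^sup>2 \<le> pi * (c + 2 * \<delta>\<^sup>2)"
    using assms by (subst (asm) ennreal_le_iff) auto
  then show thesis using assms by simp
next
  case False
  then obtain x where "x \<in> cball 0 r" "x \<notin> T \<union> ball p \<delta> \<union> ball q \<delta>" by blast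
  then show thesis by (intro that[of x]) auto
qed

text \<open>The constants depend on \<open>c\<close> alone, not on the function or the open set;
  this makes the later bounds uniform along a sequence.\<close>

lemma omits_three_values:
  fixes c :: real
  assumes c: "0 \<le> c" "c < 1"
  obtains K \<delta> where "0 < K" "0 < \<delta>"
    "\<And>V f. \<lbrakk>open V; f holomorphic_on V;
        (\<integral>\<^sup>+ z\<in>V. ennreal ((norm (deriv f z) / (1 + (norm (f z))\<^sup>2))\<^sup>2) \<partial>lborel) \<le> ennreal (pi * c)\<rbrakk>
      \<Longrightarrow> \<exists>a b d. {a, b, d} \<subseteq> cball 0 K - f ` V \<and> \<delta> \<le> dist a b \<and> \<delta> \<le> dist a d \<and> \<delta> \<le> dist b d"
proof -
  \<comment> \<open>\<open>c'\<close> lies strictly between \<open>c\<close> and 1, leaving room for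
    the open set around the image. The square of \<open>r\<close> exceeds \<open>c'\<close> by half
    of \<open>1 - c'\<close>, while the two excluded discs use up only a quarter of it.\<close>
  define c' where "c' = (1 + 3 * c) / 4"
  define r where "r = sqrt ((1 + c') / 2)"
  define \<epsilon> where "\<epsilon> = sqrt ((1 - c') / 8)"
  have c': "c < c'" "0 < c'" "c' < 1" using c by (auto simp: c'_def)
  then have r: "0 < r" "r < 1" "0 < \<epsilon>" "c' + 2 * \<epsilon>\<^sup>2 < r\<^sup>2"
    by (auto simp: r_def \<epsilon>_def real_less_lsqrt field_simps)
  define K where "K = r / sqrt (1 - r\<^sup>2)"
  have r2: "r\<^sup>2 < 1" using r by (simp add: power_less_one_iff)
  then have "K > 0" using r by (simp add: K_def)
  \<comment> \<open>Uniform continuity turns \<epsilon>-separation in the unit disc into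
    \<delta>-separation of the preimages, with one \<delta> for all functions.\<close>
  have "continuous_on (cball 0 K) sph_disc"
    using has_derivative_sph_disc
    by (intro continuous_at_imp_continuous_on ballI has_derivative_continuous) blast
  then have "uniformly_continuous_on (cball 0 K) sph_disc"
    by (intro compact_uniformly_continuous) auto
  then obtain \<delta> where "\<delta> > 0" and \<delta>: "\<And>a b. \<lbrakk>norm a \<le> K; norm b \<le> K; dist a b < \<delta>\<rbrakk>
      \<Longrightarrow> dist (sph_disc a) (sph_disc b) < \<epsilon>"
    unfolding uniformly_continuous_on_def using r(3)
    by (metis dist_commute mem_cball_0)
  show thesis
  proof
    show "0 < K" "0 < \<delta>" by fact+
    fix V and f :: "complex \<Rightarrow> complex"
    assume V: "open V" and f: "f holomorphic_on V"
      and int: "(\<integral>\<^sup>+ z\<in>V. ennreal ((norm (deriv f z) / (1 + (norm (f z))\<^sup>2))\<^sup>2) \<partial>lborel) \<le> ennreal (pi * c)"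
    define s where "s = (\<lambda>z. sqrt (1 + f z \<bullet> f z))"
    define F where "F = (\<lambda>z h. (deriv f z * h) /\<^sub>R s z - ((f z \<bullet> (deriv f z * h)) / s z ^ 3) *\<^sub>R f z)"
    have s: "s z > 0" "1 + f z \<bullet> f z = s z ^ 2" for z
      by (simp_all add: s_def add_pos_nonneg)
    have der: "((sph_disc \<circ> f) has_derivative F z) (at z)" if "z \<in> V" for z
    proof -
      have "(f has_derivative (*) (deriv f z)) (at z)"
        using holomorphic_derivI[OF f V that] by (simp add: has_field_derivative_def)
      from diff_chain_at[OF this has_derivative_sph_disc]
      show ?thesis by (simp add: o_def F_def s_def)
    qed
    have jac: "\<bar>Re (F z 1) * Im (F z \<i>) - Im (F z 1) * Re (F z \<i>)\<bar>
        = (norm (deriv f z) / (1 + (norm (f z))\<^sup>2))\<^sup>2" for z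
      unfolding F_def using s by (rule sph_disc_jacobian)
    have "continuous_on V (deriv f)" "continuous_on V f"
      using f V by (auto intro!: holomorphic_on_imp_continuous_on holomorphic_deriv)
    moreover have "1 + (norm (f z))\<^sup>2 \<noteq> 0" for z
      by (metis add_pos_nonneg less_numeral_extra(1,3) zero_le_power2)
    ultimately have cont: "continuous_on V (\<lambda>z. (norm (deriv f z) / (1 + (norm (f z))\<^sup>2))\<^sup>2)"
      by (intro continuous_on_power continuous_on_divide continuous_on_add continuous_on_norm
          continuous_on_const) auto
    have "pi * c < pi * c'" using c' by simp
    from image_subset_open_measure_le[OF V der jac cont int _ this]
    obtain T where T: "open T" "(sph_disc \<circ> f) ` V \<subseteq> T" "emeasure lborel T \<le> ennreal (pi * c')"
      using c by auto
    \<comment> \<open>The points are chosen successively, each \<epsilon>-far from the earlier ones;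
      the third has two predecessors, which is why two discs are excluded.\<close>
    note far = exists_far_point_outside[OF T(1,3) less_imp_le[OF c'(2)] r(4,3,1)]
    obtain p1 where p1: "norm p1 \<le> r" "p1 \<notin> T" by (rule far)
    obtain p2 where p2: "norm p2 \<le> r" "p2 \<notin> T" "\<epsilon> \<le> dist p1 p2" by (rule far)
    obtain p3 where p3: "norm p3 \<le> r" "p3 \<notin> T" "\<epsilon> \<le> dist p1 p3" "\<epsilon> \<le> dist p2 p3" by (rule far)
    obtain a where a: "sph_disc a = p1" "norm a \<le> K"
      unfolding K_def by (rule sph_disc_surj[OF p1(1) r(2)])
    obtain b where b: "sph_disc b = p2" "norm b \<le> K"
      unfolding K_def by (rule sph_disc_surj[OF p2(1) r(2)])
    obtain d where d: "sph_disc d = p3" "norm d \<le> K"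
      unfolding K_def by (rule sph_disc_surj[OF p3(1) r(2)])
    have "\<delta> \<le> dist a b" "\<delta> \<le> dist a d" "\<delta> \<le> dist b d"
      using \<delta>[of a b] \<delta>[of a d] \<delta>[of b d] a b d p2(3) p3(3,4) by force+
    moreover have "a \<notin> f ` V" "b \<notin> f ` V" "d \<notin> f ` V"
      using T(2) a(1) b(1) d(1) p1(2) p2(2) p3(2) by auto
    ultimately have "{a, b, d} \<subseteq> cball 0 K - f ` V \<and> \<delta> \<le> dist a b \<and> \<delta> \<le> dist a d \<and> \<delta> \<le> dist b d"
      using a(2) b(2) d(2) by simp
    then show "\<exists>a b d. {a, b, d} \<subseteq> cball 0 K - f ` V \<and> \<delta> \<le> dist a b \<and> \<delta> \<le> dist a d \<and> \<delta> \<le> dist b d"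
      by blast
  qed
qed

section \<open>Convergent subsequences on balls of small spherical area\<close>

text \<open>Convergence in the finite coordinate. Poles are excluded for large \<open>n\<close>
  because their dummy value 0 would pass for a genuine finite value.\<close>

definition finite_conv where
  "finite_conv F X h \<longleftrightarrow> h holomorphic_on X \<and>
     (\<forall>\<^sub>F n in sequentially. \<forall>w\<in>X. \<not> is_pole (F n) w) \<and>
     uniform_limit X F h sequentially" for F :: "nat \<Rightarrow> complex \<Rightarrow> complex"

text \<open>
  For functions in normal form \<open>inverse (F n w)\<close> is correct at poles, where \<open>F n w = 0\<close>; genuine zeros
  are excluded because there the junk value \<open>inverse 0 = 0\<close> would stand for infinity.
\<close>

definition inverse_conv where
  "inverse_conv F X h \<longleftrightarrow> h holomorphic_on X \<and>
     (\<forall>\<^sub>F n in sequentially. \<forall>w\<in>X. is_pole (F n) w \<or> F n w \<noteq> 0) \<and>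
     uniform_limit X (\<lambda>n w. inverse (F n w)) h sequentially" for F :: "nat \<Rightarrow> complex \<Rightarrow> complex"

text \<open>Local convergence read in one fixed coordinate of the sphere for all large
  \<open>n\<close>, so that uniform limits of holomorphic functions can be used.\<close>

definition sph_conv_at where
  "sph_conv_at F z \<longleftrightarrow> (\<exists>\<rho>>0. \<exists>h. finite_conv F (ball z \<rho>) h \<or> inverse_conv F (ball z \<rho>) h)"

section \<open>Functions with omitted values: holomorphic reciprocals, Schottky bounds and recovery
  of the limit\<close>

lemma uniform_limit_constant_sequence:
  "(b \<longlongrightarrow> \<beta>) F \<Longrightarrow> uniform_limit X (\<lambda>n _. b n) (\<lambda>_. \<beta>) F"
  unfolding uniform_limit_iff by (auto dest: tendstoD elim: eventually_mono)

lemma uniform_limit_eventually_norm_ge: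
  fixes f :: "nat \<Rightarrow> 'a \<Rightarrow> 'b::real_normed_vector"
  assumes "uniform_limit X f l sequentially" "\<And>x. x \<in> X \<Longrightarrow> m \<le> norm (l x)" "0 < m"
  shows "\<forall>\<^sub>F n in sequentially. \<forall>x\<in>X. f n x \<noteq> 0"
  using uniform_limitD[OF assms(1,3)]
proof eventually_elim
  case (elim n)
  then show ?case
    using assms(2) by (metis dist_0_norm linorder_not_less)
qed

text \<open>In normal form a point that is not a pole is a point of analyticity, and analyticity on
  a neighbourhood excludes poles nearby.\<close>

lemma nicely_meromorphic_nonpoles:
  assumes "f nicely_meromorphic_on V" "open V"
  shows "open {z\<in>V. \<not> is_pole f z}" and "f holomorphic_on {z\<in>V. \<not> is_pole f z}"
proof -
  have an: "f analytic_on {z\<in>V. \<not> is_pole f z}"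
    using assms(1) nicely_meromorphic_on_imp_analytic_at
    by (subst analytic_on_analytic_at) blast
  then show "f holomorphic_on {z\<in>V. \<not> is_pole f z}"
    by (rule analytic_imp_holomorphic)
  show "open {z\<in>V. \<not> is_pole f z}"
  proof (subst open_subopen, rule ballI)
    fix z assume z: "z \<in> {z\<in>V. \<not> is_pole f z}"
    then have "f analytic_on {z}"
      by (intro analytic_on_subset[OF an]) auto
    then obtain U where U: "open U" "z \<in> U" "f holomorphic_on U"
      unfolding analytic_at by blast
    have "\<not> is_pole f w" if "w \<in> U" for w
      using U(1) that U(3) by (rule not_is_pole_holomorphic)
    then show "\<exists>T. open T \<and> z \<in> T \<and> T \<subseteq> {z\<in>V. \<not> is_pole f z}"
      using U(1,2) z assms(2) by (intro exI[of _ "U \<inter> V"]) auto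
  qed
qed

text \<open>Since \<open>f\<close> omits \<open>b\<close>, the only singularities of
  \<open>1 / (f - b)\<close> are the poles of \<open>f\<close>. They are isolated and removable with
  value 0.\<close>

lemma holomorphic_inverse_shift:
  assumes f: "f nicely_meromorphic_on V" and "open V"
    and b: "\<And>z. \<lbrakk>z \<in> V; \<not> is_pole f z\<rbrakk> \<Longrightarrow> f z \<noteq> b"
  shows "(\<lambda>z. if is_pole f z then 0 else inverse (f z - b)) holomorphic_on V" (is "?h holomorphic_on V")
proof -
  let ?N = "{z\<in>V. \<not> is_pole f z}"
  note N = nicely_meromorphic_nonpoles[OF f \<open>open V\<close>]
  have "?h analytic_on {z}" if "z \<in> V" for z
  proof (cases "is_pole f z")
    case False
    have "(\<lambda>z. inverse (f z - b)) holomorphic_on ?N"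
      using b by (intro holomorphic_intros N) auto
    then have "?h holomorphic_on ?N"
      by (rule holomorphic_transform) auto
    then show ?thesis
      using N(1) False that by (auto simp: analytic_at)
  next
    case True
    have "f meromorphic_on {z}"
      using f that by (auto simp: nicely_meromorphic_on_def intro: meromorphic_on_subset)
    then have "eventually (\<lambda>w. f analytic_on {w}) (at z)"
      using meromorphic_on_isolated_singularity isolated_singularity_at_altdef by blast
    moreover have "eventually (\<lambda>w. w \<in> V) (at z)"
      using \<open>open V\<close> that by (simp add: eventually_at_in_open')
    ultimately have "eventually (\<lambda>w. w \<in> V \<and> \<not> is_pole f w) (at z)"
      by eventually_elim (use analytic_at_imp_no_pole in blast)
    then obtain U where U: "open U" "z \<in> U" "\<And>w. \<lbrakk>w \<in> U; w \<noteq> z\<rbrakk> \<Longrightarrow> w \<in> V \<and> \<not> is_pole f w"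
      unfolding eventually_at_topological by blast
    have "(\<lambda>w. if w = z then 0 else inverse (f w - b)) holomorphic_on U"
    proof (rule is_pole_inverse_holomorphic)
      show "(\<lambda>w. f w - b) holomorphic_on U - {z}"
        using U by (intro holomorphic_intros holomorphic_on_subset[OF N(2)]) auto
      show "is_pole (\<lambda>w. f w - b) z"
        using True is_pole_plus_const_iff[of f z "- b"] by simp
      show "\<forall>w\<in>U - {z}. f w - b \<noteq> 0"
        using U b by auto
    qed fact
    then have "?h holomorphic_on U"
      by (rule holomorphic_transform) (use U True in auto)
    then show ?thesis
      using U by (auto simp: analytic_at)
  qed
  then show ?thesis
    using analytic_imp_holomorphic analytic_on_analytic_at by blast
qed

text \<open>\<open>Schottky\<close> is stated on the closed unit disc. Rescaling by a radius
  \<sigma> strictly between \<rho> and \<open>R\<close> puts that disc inside the domain and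
  \<open>cball z0 \<rho>\<close> inside the disc of radius \<open>t < 1\<close>.\<close>

lemma Schottky_ball:
  assumes "0 < \<rho>" "\<rho> < R"
  obtains M where "0 < M" "\<And>g z. \<lbrakk>g holomorphic_on ball z0 R; norm (g z0) \<le> 1;
      \<And>z. z \<in> ball z0 R \<Longrightarrow> g z \<noteq> 0 \<and> g z \<noteq> 1; z \<in> cball z0 \<rho>\<rbrakk> \<Longrightarrow> norm (g z) \<le> M"
proof
  define \<sigma> where "\<sigma> = (\<rho> + R) / 2"
  define t where "t = \<rho> / \<sigma>"
  have \<sigma>: "0 < \<sigma>" "\<rho> < \<sigma>" "\<sigma> < R" using assms by (auto simp: \<sigma>_def)
  \<comment> \<open>The bound of \<open>Schottky\<close> for functions of modulus at most 1 at the
    centre.\<close>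
  define M where "M = exp (pi * exp (pi * (2 + 2 * 1 + 12 * t / (1 - t))))"
  show "0 < M" by (simp add: M_def)
  fix g z assume g: "g holomorphic_on ball z0 R" "norm (g z0) \<le> 1"
    and avoid: "\<And>z. z \<in> ball z0 R \<Longrightarrow> g z \<noteq> 0 \<and> g z \<noteq> 1" and z: "z \<in> cball z0 \<rho>"
  define G where "G = (\<lambda>w. g (z0 + of_real \<sigma> * w))"
  have in_ball: "z0 + of_real \<sigma> * w \<in> ball z0 R" if "w \<in> cball 0 1" for w
  proof -
    have "\<sigma> * norm w \<le> \<sigma> * 1" using that \<sigma> by (intro mult_left_mono) auto
    then have "\<sigma> * norm w < R" using \<sigma> by linarith
    then show ?thesis using \<sigma> by (simp add: dist_norm norm_mult)
  qed
  have "norm (G ((z - z0) / of_real \<sigma>)) \<le> M"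
    unfolding M_def
  proof (rule Schottky[where f = G])
    have "g \<circ> (\<lambda>w. z0 + of_real \<sigma> * w) holomorphic_on cball 0 1"
      using in_ball by (intro holomorphic_on_compose_gen[OF _ g(1)] holomorphic_intros) auto
    then show "G holomorphic_on cball 0 1" by (simp add: G_def o_def)
    show "norm (G 0) \<le> 1" using g by (simp add: G_def)
    show "\<not> (G w = 0 \<or> G w = 1)" if "w \<in> cball 0 1" for w
      using avoid in_ball[OF that] by (auto simp: G_def)
    show "0 < t" "t < 1" using assms \<sigma> by (auto simp: t_def)
    show "norm ((z - z0) / of_real \<sigma>) \<le> t"
      using z \<sigma> by (simp add: t_def norm_divide dist_norm norm_minus_commute divide_right_mono)
  qed
  then show "norm (g z) \<le> M"
    using \<sigma> by (simp add: G_def)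
qed

text \<open>The cross ratio of \<open>w\<close> with \<open>a, b, d\<close>, written in terms of \<open>1 / (w - b)\<close> so that it extends to \<open>w = \<infinity>\<close>.\<close>

lemma moebius_avoids_0_1:
  fixes w a b d :: complex
  assumes "w \<notin> {a, b, d}" "a \<noteq> b" "a \<noteq> d" "b \<noteq> d"
  shows "(d - b) / (d - a) * (1 + (b - a) * inverse (w - b)) \<noteq> 0"
    and "(d - b) / (d - a) * (1 + (b - a) * inverse (w - b)) \<noteq> 1"
    and "(d - b) / (d - a) * (1 + (b - a) * inverse (w - b)) = (d - b) / (d - a) * ((w - a) / (w - b))"
proof -
  have "1 + (b - a) * inverse (w - b) = (w - a) / (w - b)"
    using assms by (simp add: field_simps)
  then show eq: "(d - b) / (d - a) * (1 + (b - a) * inverse (w - b)) = (d - b) / (d - a) * ((w - a) / (w - b))"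
    by simp
  show "(d - b) / (d - a) * (1 + (b - a) * inverse (w - b)) \<noteq> 0"
    unfolding eq using assms by simp
  have "(d - b) * (w - a) - (d - a) * (w - b) = (a - b) * (w - d)" by algebra
  then have "(d - b) * (w - a) \<noteq> (d - a) * (w - b)" using assms by auto
  then show "(d - b) / (d - a) * (1 + (b - a) * inverse (w - b)) \<noteq> 1"
    unfolding eq using assms by (simp add: divide_eq_1_iff)
qed

text \<open>The affine expression is solved for \<open>h\<close>; boundedness and separation of the
  three points keep the resulting constant independent of them.\<close>

lemma norm_inverse_shift_le:
  fixes a b d h :: complex
  assumes abd: "norm a \<le> K" "norm b \<le> K" "norm d \<le> K" "\<delta> \<le> dist a b" "\<delta> \<le> dist b d" "a \<noteq> d"
    and "0 < \<delta>" "0 < M" "0 < K"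
    and le: "norm ((d - b) / (d - a) * (1 + (b - a) * h)) \<le> M"
  shows "norm h \<le> (M * (2 * K / \<delta>) + 1) / \<delta>"
proof -
  have "norm ((d - a) / (d - b)) \<le> 2 * K / \<delta>"
    unfolding norm_divide using abd \<open>0 < \<delta>\<close> \<open>0 < K\<close> norm_triangle_ineq4[of d a]
    by (intro frac_le) (auto simp: dist_norm norm_minus_commute)
  then have "norm ((d - b) / (d - a) * (1 + (b - a) * h)) * norm ((d - a) / (d - b)) \<le> M * (2 * K / \<delta>)"
    using le \<open>0 < M\<close> by (intro mult_mono) auto
  moreover have "b \<noteq> d" using abd \<open>0 < \<delta>\<close> by auto
  ultimately have "norm (1 + (b - a) * h) \<le> M * (2 * K / \<delta>)"
    using \<open>a \<noteq> d\<close> by (simp flip: norm_mult)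
  then have "norm ((b - a) * h) \<le> M * (2 * K / \<delta>) + 1"
    using norm_triangle_ineq4[of "1 + (b - a) * h" 1] by simp
  moreover have "\<delta> * norm h \<le> norm ((b - a) * h)"
    unfolding norm_mult using abd by (intro mult_right_mono) (auto simp: dist_norm norm_minus_commute)
  ultimately show ?thesis
    using \<open>0 < \<delta>\<close> by (simp add: pos_le_divide_eq mult.commute)
qed

text \<open>Undoes the shift. If \<open>H z\<close> is non-zero, \<open>F n = b n + 1 / h n\<close>
  converges near \<open>z\<close> to a finite limit. If \<open>H z = 0\<close>, the other coordinate
  is used: \<open>1 / F n = h n / (1 + b n * h n)\<close>, with denominator close to 1.\<close>

lemma sph_conv_at_of_inverse_shift:
  fixes F h :: "nat \<Rightarrow> complex \<Rightarrow> complex"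
  assumes "open V" "z \<in> V"
    and h: "\<And>n w. h n w = (if is_pole (F n) w then 0 else inverse (F n w - b n))"
    and b: "\<And>n w. \<lbrakk>w \<in> V; \<not> is_pole (F n) w\<rbrakk> \<Longrightarrow> F n w \<noteq> b n"
    and F: "\<And>n w. \<lbrakk>w \<in> V; is_pole (F n) w\<rbrakk> \<Longrightarrow> F n w = 0"
    and "b \<longlonglongrightarrow> \<beta>" "H holomorphic_on V"
    and lim: "\<And>K. \<lbrakk>compact K; K \<subseteq> V\<rbrakk> \<Longrightarrow> uniform_limit K h H sequentially"
  shows "sph_conv_at F z"
proof -
  have contH: "continuous_on V H"
    using \<open>H holomorphic_on V\<close> by (rule holomorphic_on_imp_continuous_on)
  \<comment> \<open>Closed balls, because the convergence of \<open>h\<close> is given on compact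
    sets.\<close>
  have nbhd: "\<exists>\<rho>>0. cball z \<rho> \<subseteq> V \<and> (\<forall>w\<in>cball z \<rho>. P (H w))" if "open {x. P x}" "P (H z)" for P
  proof -
    have "open (V \<inter> H -` {x. P x})"
      using contH \<open>open V\<close> that(1) by (rule continuous_open_preimage)
    moreover have "z \<in> V \<inter> H -` {x. P x}"
      using that(2) \<open>z \<in> V\<close> by simp
    ultimately obtain \<rho> where "0 < \<rho>" "cball z \<rho> \<subseteq> V \<inter> H -` {x. P x}"
      unfolding open_contains_cball by blast
    then show ?thesis by (intro exI[of _ \<rho>]) auto
  qed
  have b_lim: "uniform_limit X (\<lambda>n _. b n) (\<lambda>_. \<beta>) sequentially" for X :: "complex set"
    using \<open>b \<longlonglongrightarrow> \<beta>\<close> by (rule uniform_limit_constant_sequence)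
  show ?thesis
  proof (cases "H z = 0")
    case False
    define m where "m = norm (H z) / 2"
    have m: "0 < m" "m < norm (H z)" using False by (auto simp: m_def)
    have "open {x::complex. m < norm x}" by (intro open_Collect_less continuous_intros)
    from nbhd[OF this m(2)] obtain \<rho> where \<rho>: "0 < \<rho>" "cball z \<rho> \<subseteq> V" "\<And>w. w \<in> cball z \<rho> \<Longrightarrow> m < norm (H w)"
      by blast
    have hH: "uniform_limit (cball z \<rho>) h H sequentially" using \<rho> by (intro lim) auto
    have nz: "\<forall>\<^sub>F n in sequentially. \<forall>x\<in>cball z \<rho>. h n x \<noteq> 0"
      by (rule uniform_limit_eventually_norm_ge[OF hH _ m(1)]) (use \<rho> in \<open>auto intro: less_imp_le\<close>)
    have "finite_conv F (ball z \<rho>) (\<lambda>w. \<beta> + inverse (H w))"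
      unfolding finite_conv_def
    proof (intro conjI)
      show "(\<lambda>w. \<beta> + inverse (H w)) holomorphic_on ball z \<rho>"
      proof (intro holomorphic_intros holomorphic_on_subset[OF \<open>H holomorphic_on V\<close>])
        show "ball z \<rho> \<subseteq> V" using \<rho>(2) ball_subset_cball by blast
        show "H w \<noteq> 0" if "w \<in> ball z \<rho>" for w using \<rho>(3)[of w] that m by auto
      qed
      show "\<forall>\<^sub>F n in sequentially. \<forall>w\<in>ball z \<rho>. \<not> is_pole (F n) w"
        using nz
      proof eventually_elim
        case (elim n)
        then show ?case using h[of n] by (metis ball_subset_cball subsetD)
      qed
      have "uniform_limit (cball z \<rho>) (\<lambda>n w. inverse (h n w)) (inverse \<circ> H) sequentially"
        using hH \<rho> m by (intro uniform_lim_inverse[of _ _ _ _ m]) (auto intro: less_imp_le)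
      from uniform_limit_add[OF b_lim this]
      have "uniform_limit (ball z \<rho>) (\<lambda>n w. b n + inverse (h n w)) (\<lambda>w. \<beta> + inverse (H w)) sequentially"
        unfolding o_def by (rule uniform_limit_on_subset) auto
      moreover have "\<forall>\<^sub>F n in sequentially. \<forall>w\<in>ball z \<rho>. b n + inverse (h n w) = F n w"
        using nz
      proof eventually_elim
        case (elim n)
        show ?case
        proof
          fix w assume "w \<in> ball z \<rho>"
          then have "h n w \<noteq> 0" using elim by auto
          then have "\<not> is_pole (F n) w" using h by auto
          then show "b n + inverse (h n w) = F n w" by (simp add: h)
        qed
      qed
      ultimately show "uniform_limit (ball z \<rho>) F (\<lambda>w. \<beta> + inverse (H w)) sequentially"
        by (subst (asm) uniform_limit_cong) auto
    qed
    then show ?thesis using \<rho> unfolding sph_conv_at_def by blast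
  next
    case True
    \<comment> \<open>Both inequalities hold at the zero of \<open>H\<close>: the first keeps the
      denominator away from 0, the second bounds the numerator.\<close>
    have op: "open {x::complex. 1 / 2 < norm (1 + \<beta> * x) \<and> norm x < 1}"
      by (intro open_Collect_conj open_Collect_less continuous_intros)
    have "1 / 2 < norm (1 + \<beta> * H z) \<and> norm (H z) < 1" using True by simp
    from nbhd[OF op this] obtain \<rho> where \<rho>: "0 < \<rho>" "cball z \<rho> \<subseteq> V"
      "\<And>w. w \<in> cball z \<rho> \<Longrightarrow> 1 / 2 < norm (1 + \<beta> * H w) \<and> norm (H w) < 1"
      by blast
    have hH: "uniform_limit (cball z \<rho>) h H sequentially" using \<rho> by (intro lim) auto
    have bH: "bounded (H ` cball z \<rho>)"
      using \<rho> by (auto simp: bounded_iff intro!: exI[of _ 1] less_imp_le)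
    have den: "uniform_limit (cball z \<rho>) (\<lambda>n w. 1 + b n * h n w) (\<lambda>w. 1 + \<beta> * H w) sequentially"
      by (intro uniform_limit_add uniform_limit_const uniform_lim_mult b_lim hH bH)
        (auto simp: image_constant_conv)
    have nz: "\<forall>\<^sub>F n in sequentially. \<forall>x\<in>cball z \<rho>. 1 + b n * h n x \<noteq> 0"
      by (rule uniform_limit_eventually_norm_ge[OF den, of "1 / 2"]) (use \<rho> in \<open>auto intro: less_imp_le\<close>)
    \<comment> \<open>At a pole both sides are 0: \<open>h n w\<close> is 0 there, and
      \<open>F n w\<close> has the dummy value 0, whose \<open>inverse\<close> is 0.\<close>
    have quot: "h n w / (1 + b n * h n w) = inverse (F n w)" if "w \<in> V" for n w
    proof (cases "is_pole (F n) w")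
      case True
      then show ?thesis using F[OF that True] by (simp add: h)
    next
      case False
      then have "F n w - b n \<noteq> 0" using b[OF that] by simp
      moreover from this have "1 + b n * inverse (F n w - b n) = F n w * inverse (F n w - b n)"
        by (simp add: field_simps)
      ultimately show ?thesis using False by (simp add: h divide_inverse)
    qed
    have "inverse_conv F (ball z \<rho>) (\<lambda>w. H w / (1 + \<beta> * H w))"
      unfolding inverse_conv_def
    proof (intro conjI)
      have "1 + \<beta> * H w \<noteq> 0" if "w \<in> ball z \<rho>" for w
      proof
        assume "1 + \<beta> * H w = 0"
        then show False using \<rho>(3)[of w] that by simp
      qed
      then show "(\<lambda>w. H w / (1 + \<beta> * H w)) holomorphic_on ball z \<rho>"
        using \<rho>(2) ball_subset_cball[of z \<rho>]
        by (intro holomorphic_intros holomorphic_on_subset[OF \<open>H holomorphic_on V\<close>]) auto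
      show "\<forall>\<^sub>F n in sequentially. \<forall>w\<in>ball z \<rho>. is_pole (F n) w \<or> F n w \<noteq> 0"
        using nz
      proof eventually_elim
        case (elim n)
        show ?case
        proof
          fix w assume w: "w \<in> ball z \<rho>"
          then have V: "w \<in> V" and "1 + b n * h n w \<noteq> 0" using elim \<rho>(2) by auto
          \<comment> \<open>Hence the quotient is non-zero off the poles, so by \<open>quot\<close>
            the function has no genuine zero.\<close>
          moreover have "h n w \<noteq> 0" if "\<not> is_pole (F n) w"
            using b[OF V that] that by (simp add: h)
          ultimately show "is_pole (F n) w \<or> F n w \<noteq> 0"
            using quot[OF V, of n] by (metis divide_eq_0_iff inverse_zero)
        qed
      qed
      have "uniform_limit (cball z \<rho>) (\<lambda>n w. h n w / (1 + b n * h n w)) (\<lambda>w. H w / (1 + \<beta> * H w)) sequentially"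
        using \<rho>(3) by (intro uniform_lim_divide[OF hH den bH, of "1 / 2"]) (auto intro: less_imp_le)
      then have "uniform_limit (ball z \<rho>) (\<lambda>n w. h n w / (1 + b n * h n w)) (\<lambda>w. H w / (1 + \<beta> * H w)) sequentially"
        by (rule uniform_limit_on_subset) auto
      moreover have "h n w / (1 + b n * h n w) = inverse (F n w)" if "w \<in> ball z \<rho>" for n w
        using that \<rho>(2) by (intro quot) auto
      ultimately show "uniform_limit (ball z \<rho>) (\<lambda>n w. inverse (F n w)) (\<lambda>w. H w / (1 + \<beta> * H w)) sequentially"
        by (subst (asm) uniform_limit_cong) auto
    qed
    then show ?thesis using \<rho> unfolding sph_conv_at_def by blast
  qed
qed

text \<open>The poles are left out because there \<^const>\<open>sph_deriv\<close> is a limit whose measurability would need an argument.\<close>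

definition nonpole_area :: "(complex \<Rightarrow> complex) \<Rightarrow> complex set \<Rightarrow> ennreal" where
  "nonpole_area f V =
     (\<integral>\<^sup>+ z\<in>{z\<in>V. \<not> is_pole f z}. ennreal ((norm (deriv f z) / (1 + (norm (f z))\<^sup>2))\<^sup>2) \<partial>lborel)"

text \<open>The value at a pole is the continuous extension of \<open>1 / (f - b)\<close>.\<close>

definition inverse_shift :: "(complex \<Rightarrow> complex) \<Rightarrow> complex \<Rightarrow> complex \<Rightarrow> complex" where
  "inverse_shift f b z = (if is_pole f z then 0 else inverse (f z - b))"

text \<open>At a pole the expression is \<open>(d - b) / (d - a)\<close>, which differs from 0 and 1
  because the three points are distinct.\<close>

lemma moebius_inverse_shift_avoids_0_1:
  assumes "\<not> is_pole f z \<Longrightarrow> f z \<notin> {a, b, d}" "a \<noteq> b" "a \<noteq> d" "b \<noteq> d"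
  shows "(d - b) / (d - a) * (1 + (b - a) * inverse_shift f b z) \<notin> {0, 1}"
proof (cases "is_pole f z")
  case True
  then show ?thesis using assms by (simp add: inverse_shift_def)
next
  case False
  then show ?thesis
    using moebius_avoids_0_1(1,2)[of "f z" a b d] assms by (simp add: inverse_shift_def)
qed

text \<open>Interchanging \<open>a\<close> and \<open>b\<close> inverts the cross ratio, so one of the two orders has modulus at most 1 at a given point.\<close>

lemma moebius_inverse_shift_swap:
  assumes "\<not> is_pole f z \<Longrightarrow> f z \<notin> {a, b, d}" "a \<noteq> b" "a \<noteq> d" "b \<noteq> d"
  shows "((d - b) / (d - a) * (1 + (b - a) * inverse_shift f b z)) *
    ((d - a) / (d - b) * (1 + (a - b) * inverse_shift f a z)) = 1"
proof (cases "is_pole f z")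
  case True
  then show ?thesis using assms by (simp add: inverse_shift_def)
next
  case False
  then have w: "f z \<notin> {a, b, d}" "f z \<notin> {b, a, d}" using assms by auto
  have "(d - b) / (d - a) * ((f z - a) / (f z - b)) * ((d - a) / (d - b) * ((f z - b) / (f z - a))) = 1"
    using assms w by simp
  then show ?thesis
    using moebius_avoids_0_1(3)[OF w(1)] moebius_avoids_0_1(3)[OF w(2)] assms False
    by (simp add: inverse_shift_def)
qed

text \<open>Schottky's theorem asks for control at the centre. The two cross ratios obtained by
  interchanging \<open>a\<close> and \<open>b\<close> have product 1, so a suitable order provides
  it.\<close>

lemma omits_three_values_normalized:
  fixes c :: real
  assumes c: "0 \<le> c" "c < 1"
  obtains K \<delta> where "0 < K" "0 < \<delta>"
    "\<And>V f z0. \<lbrakk>open V; f nicely_meromorphic_on V; nonpole_area f V \<le> ennreal (pi * c); z0 \<in> V\<rbrakk>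
      \<Longrightarrow> \<exists>a b d. {a, b, d} \<subseteq> cball 0 K \<and> \<delta> \<le> dist a b \<and> \<delta> \<le> dist a d \<and> \<delta> \<le> dist b d \<and>
        (\<forall>z\<in>V. \<not> is_pole f z \<longrightarrow> f z \<notin> {a, b, d}) \<and>
        norm ((d - b) / (d - a) * (1 + (b - a) * inverse_shift f b z0)) \<le> 1"
proof -
  obtain K \<delta> where K: "0 < K" "0 < \<delta>" and omit: "\<And>V f. \<lbrakk>open V; f holomorphic_on V;
        (\<integral>\<^sup>+ z\<in>V. ennreal ((norm (deriv f z) / (1 + (norm (f z))\<^sup>2))\<^sup>2) \<partial>lborel) \<le> ennreal (pi * c)\<rbrakk>
      \<Longrightarrow> \<exists>a b d. {a, b, d} \<subseteq> cball 0 K - f ` V \<and> \<delta> \<le> dist a b \<and> \<delta> \<le> dist a d \<and> \<delta> \<le> dist b d"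
    using omits_three_values[OF c] by blast
  show thesis
  proof
    show "0 < K" "0 < \<delta>" by fact+
    fix V f and z0 :: complex
    assume V: "open V" and f: "f nicely_meromorphic_on V"
      and area: "nonpole_area f V \<le> ennreal (pi * c)" and z0: "z0 \<in> V"
    obtain a b d where abd: "{a, b, d} \<subseteq> cball 0 K - f ` {z\<in>V. \<not> is_pole f z}"
        "\<delta> \<le> dist a b" "\<delta> \<le> dist a d" "\<delta> \<le> dist b d"
      using omit[OF nicely_meromorphic_nonpoles[OF f V]] area unfolding nonpole_area_def by blast
    have ne: "a \<noteq> b" "a \<noteq> d" "b \<noteq> d" using abd(2-4) K by auto
    have om: "f z \<notin> {a, b, d}" if "z \<in> V" "\<not> is_pole f z" for z
    proof -
      have "f z \<in> f ` {z\<in>V. \<not> is_pole f z}" using that by blast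
      then show ?thesis using abd(1) by blast
    qed
    define G where "G = (\<lambda>a b. (d - b) / (d - a) * (1 + (b - a) * inverse_shift f b z0))"
    have "G a b * G b a = 1"
      unfolding G_def using om[OF z0] ne by (intro moebius_inverse_shift_swap)
    then have "norm (G a b) * norm (G b a) = 1"
      by (metis norm_mult norm_one)
    then consider "norm (G a b) \<le> 1" | "norm (G b a) \<le> 1"
      by (metis less_1_mult linorder_not_le order_less_irrefl)
    then show "\<exists>a b d. {a, b, d} \<subseteq> cball 0 K \<and> \<delta> \<le> dist a b \<and> \<delta> \<le> dist a d \<and> \<delta> \<le> dist b d \<and>
        (\<forall>z\<in>V. \<not> is_pole f z \<longrightarrow> f z \<notin> {a, b, d}) \<and>
        norm ((d - b) / (d - a) * (1 + (b - a) * inverse_shift f b z0)) \<le> 1"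
    proof cases
      case 1
      then show ?thesis using abd om
        by (intro exI[of _ a] exI[of _ b] exI[of _ d]) (auto simp: G_def)
    next
      case 2
      then show ?thesis using abd om
        by (intro exI[of _ b] exI[of _ a] exI[of _ d]) (auto simp: G_def dist_commute)
    qed
  qed
qed

lemma compact_subset_ball_cball:
  fixes z0 :: "'a::real_normed_vector"
  assumes "compact X" "X \<subseteq> ball z0 R" "0 < R"
  obtains \<rho> where "0 < \<rho>" "\<rho> < R" "X \<subseteq> cball z0 \<rho>"
proof (cases "X = {}")
  case True
  then show thesis using that[of "R / 2"] assms by auto
next
  case False
  have "continuous_on X (dist z0)" by (intro continuous_intros)
  then obtain x where x: "x \<in> X" "\<And>y. y \<in> X \<Longrightarrow> dist z0 y \<le> dist z0 x"
    using continuous_attains_sup[OF assms(1) False] by blast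
  have "dist z0 x < R" using x(1) assms(2) by auto
  \<comment> \<open>The maximum with \<open>R / 2\<close> keeps the radius positive even if
    \<open>X\<close> is just the centre.\<close>
  moreover have "X \<subseteq> cball z0 (max (dist z0 x) (R / 2))"
    using x(2) by (auto simp: le_max_iff_disj)
  ultimately show thesis
    using assms(3) by (intro that[of "max (dist z0 x) (R / 2)"]) auto
qed

text \<open>The omitted values vary with \<open>n\<close>, but stay bounded and separated. Schottky
  makes the shifted reciprocals a normal family; compactness lets the shifts converge as well, so
  the limit can be carried back to \<open>F\<close>.\<close>

proposition small_area_subseq_convergent:
  fixes F :: "nat \<Rightarrow> complex \<Rightarrow> complex"
  assumes c: "0 \<le> c" "c < 1" and "0 < R"
    and F: "\<And>n. F n nicely_meromorphic_on ball z0 R"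
    and area: "\<And>n. nonpole_area (F n) (ball z0 R) \<le> ennreal (pi * c)"
  obtains r where "strict_mono r" "\<And>z. z \<in> ball z0 R \<Longrightarrow> sph_conv_at (F \<circ> r) z"
proof -
  let ?B = "ball z0 R"
  obtain K \<delta> where K: "0 < K" "0 < \<delta>" and
    omit: "\<And>V f z0. \<lbrakk>open V; f nicely_meromorphic_on V; nonpole_area f V \<le> ennreal (pi * c); z0 \<in> V\<rbrakk>
      \<Longrightarrow> \<exists>a b d. {a, b, d} \<subseteq> cball 0 K \<and> \<delta> \<le> dist a b \<and> \<delta> \<le> dist a d \<and> \<delta> \<le> dist b d \<and>
        (\<forall>z\<in>V. \<not> is_pole f z \<longrightarrow> f z \<notin> {a, b, d}) \<and>
        norm ((d - b) / (d - a) * (1 + (b - a) * inverse_shift f b z0)) \<le> 1"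
    using omits_three_values_normalized[OF c] by blast
  have "z0 \<in> ?B" using \<open>0 < R\<close> by simp
  from omit[OF open_ball F area this]
  obtain a b d where
    abd: "\<And>n. {a n, b n, d n} \<subseteq> cball 0 K" "\<And>n. \<delta> \<le> dist (a n) (b n)" "\<And>n. \<delta> \<le> dist (a n) (d n)"
      "\<And>n. \<delta> \<le> dist (b n) (d n)"
    and om: "\<And>n z. \<lbrakk>z \<in> ?B; \<not> is_pole (F n) z\<rbrakk> \<Longrightarrow> F n z \<notin> {a n, b n, d n}"
    and le1: "\<And>n. norm ((d n - b n) / (d n - a n) * (1 + (b n - a n) * inverse_shift (F n) (b n) z0)) \<le> 1"
    by metis
  have ne: "a n \<noteq> b n" "a n \<noteq> d n" "b n \<noteq> d n" for n
    using abd(2-4)[of n] K by auto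
  define h where "h = (\<lambda>n. inverse_shift (F n) (b n))"
  have hol: "h n holomorphic_on ?B" for n
    unfolding h_def inverse_shift_def using om[of _ n]
    by (intro holomorphic_inverse_shift[OF F]) auto
  \<comment> \<open>Schottky bounds the cross ratio on \<open>X\<close>, and the affine inversion
    transfers the bound to \<open>h\<close>.\<close>
  have bounded: "\<exists>M. \<forall>g\<in>range h. \<forall>z\<in>X. norm (g z) \<le> M" if X: "compact X" "X \<subseteq> ?B" for X
  proof -
    obtain \<rho> where \<rho>: "0 < \<rho>" "\<rho> < R" "X \<subseteq> cball z0 \<rho>"
      using compact_subset_ball_cball[OF X \<open>0 < R\<close>] .
    obtain M where M: "0 < M" "\<And>g z. \<lbrakk>g holomorphic_on ?B; norm (g z0) \<le> 1;
      \<And>z. z \<in> ?B \<Longrightarrow> g z \<noteq> 0 \<and> g z \<noteq> 1; z \<in> cball z0 \<rho>\<rbrakk> \<Longrightarrow> norm (g z) \<le> M"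
      using Schottky_ball[OF \<rho>(1,2)] by blast
    have "norm (h n z) \<le> (M * (2 * K / \<delta>) + 1) / \<delta>" if "z \<in> X" for n z
    proof (rule norm_inverse_shift_le)
      define g where "g = (\<lambda>z. (d n - b n) / (d n - a n) * (1 + (b n - a n) * h n z))"
      have "norm (g z) \<le> M"
      proof (rule M(2)[where g = g])
        show "g holomorphic_on ?B"
          unfolding g_def by (intro holomorphic_intros hol)
        show "norm (g z0) \<le> 1"
          using le1[of n] by (simp add: g_def h_def)
        show "g w \<noteq> 0 \<and> g w \<noteq> 1" if "w \<in> ?B" for w
          using moebius_inverse_shift_avoids_0_1[of "F n" w "a n" "b n" "d n"] om[OF that, of n] ne[of n]
          by (simp add: g_def h_def)
        show "z \<in> cball z0 \<rho>" using that \<rho> by auto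
      qed
      then show "norm ((d n - b n) / (d n - a n) * (1 + (b n - a n) * h n z)) \<le> M"
        by (simp add: g_def)
    qed (use abd[of n] ne K M in auto)
    then show ?thesis by blast
  qed
  \<comment> \<open>A first subsequence makes the shifts \<open>b n\<close> converge; Montel
    extracts the second one from it.\<close>
  have "\<forall>n. b n \<in> cball 0 K" using abd(1) by blast
  then obtain \<beta> r1 where r1: "strict_mono r1" "(b \<circ> r1) \<longlonglongrightarrow> \<beta>"
    using compact_cball[of 0 K] unfolding compact_def by metis
  obtain H r2 where H: "H holomorphic_on ?B" "strict_mono r2"
    "\<And>X. \<lbrakk>compact X; X \<subseteq> ?B\<rbrakk> \<Longrightarrow> uniform_limit X ((h \<circ> r1) \<circ> r2) H sequentially"
  proof (rule Montel[of ?B "range h" "h \<circ> r1"])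
    show "g holomorphic_on ?B" if "g \<in> range h" for g using that hol by auto
  qed (use bounded in \<open>auto simp: o_def\<close>)
  show thesis
  proof
    show "strict_mono (r1 \<circ> r2)" using r1 H by (intro strict_mono_o)
    fix z assume z: "z \<in> ?B"
    show "sph_conv_at (F \<circ> (r1 \<circ> r2)) z"
    proof (rule sph_conv_at_of_inverse_shift[where V = ?B and h = "h \<circ> r1 \<circ> r2" and b = "b \<circ> r1 \<circ> r2"])
      show "(b \<circ> r1 \<circ> r2) \<longlonglongrightarrow> \<beta>"
        using LIMSEQ_subseq_LIMSEQ[OF r1(2) H(2)] .
      show "(F \<circ> (r1 \<circ> r2)) n w = 0" if "w \<in> ?B" "is_pole ((F \<circ> (r1 \<circ> r2)) n) w" for n w
        using is_pole_zero_at_nicely_mero[OF F] that by auto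
      show "(F \<circ> (r1 \<circ> r2)) n w \<noteq> (b \<circ> r1 \<circ> r2) n" if "w \<in> ?B" "\<not> is_pole ((F \<circ> (r1 \<circ> r2)) n) w" for n w
        using om that by auto
    qed (use H z in \<open>auto simp: h_def inverse_shift_def\<close>)
  qed
qed

section \<open>Gluing of local limits\<close>

lemma finite_conv_mono: "finite_conv F X h \<Longrightarrow> Y \<subseteq> X \<Longrightarrow> finite_conv F Y h"
  unfolding finite_conv_def
  by (auto intro: holomorphic_on_subset uniform_limit_on_subset elim!: eventually_mono)

lemma inverse_conv_mono: "inverse_conv F X h \<Longrightarrow> Y \<subseteq> X \<Longrightarrow> inverse_conv F Y h"
  unfolding inverse_conv_def
  by (auto intro: holomorphic_on_subset uniform_limit_on_subset elim!: eventually_mono)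

lemma finite_conv_sph_dist:
  assumes "finite_conv F X h" "0 < \<epsilon>"
  shows "\<forall>\<^sub>F n in sequentially. \<forall>w\<in>X. sph_dist (sph_val (F n) w) (Some (h w)) < ennreal \<epsilon>"
proof -
  have "\<forall>\<^sub>F n in sequentially. \<forall>w\<in>X. dist (F n w) (h w) < \<epsilon>"
    "\<forall>\<^sub>F n in sequentially. \<forall>w\<in>X. \<not> is_pole (F n) w"
    using assms by (auto simp: finite_conv_def dest: uniform_limitD)
  then show ?thesis
  proof eventually_elim
    case (elim n)
    show ?case
    proof
      fix w assume "w \<in> X"
      then have "sph_dist (sph_val (F n) w) (Some (h w)) \<le> ennreal (dist (F n w) (h w))"
        using elim(2) by (simp add: sph_val_def sph_dist_Some_le)
      also have "\<dots> < ennreal \<epsilon>"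
        using elim(1) \<open>w \<in> X\<close> by (intro ennreal_lessI assms(2)) auto
      finally show "sph_dist (sph_val (F n) w) (Some (h w)) < ennreal \<epsilon>" .
    qed
  qed
qed

lemma inverse_conv_sph_dist:
  assumes "inverse_conv F X h" "0 < \<epsilon>"
    and pole: "\<And>n w. \<lbrakk>w \<in> X; is_pole (F n) w\<rbrakk> \<Longrightarrow> F n w = 0"
  shows "\<forall>\<^sub>F n in sequentially. \<forall>w\<in>X. sph_dist (sph_val (F n) w) (sph_inv (h w)) < ennreal \<epsilon>"
proof -
  have "\<forall>\<^sub>F n in sequentially. \<forall>w\<in>X. dist (inverse (F n w)) (h w) < \<epsilon>"
    "\<forall>\<^sub>F n in sequentially. \<forall>w\<in>X. is_pole (F n) w \<or> F n w \<noteq> 0"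
    using assms by (auto simp: inverse_conv_def dest: uniform_limitD)
  then show ?thesis
  proof eventually_elim
    case (elim n)
    show ?case
    proof
      fix w assume w: "w \<in> X"
      \<comment> \<open>At a pole \<open>inverse (F n w)\<close> is 0 through the dummy value, and
        \<open>sph_inv\<close> sends it to infinity as it should.\<close>
      then have "sph_val (F n) w = sph_inv (inverse (F n w))"
        using elim(2) pole[OF w] by (auto simp: sph_val_def sph_inv_def)
      then have "sph_dist (sph_val (F n) w) (sph_inv (h w)) \<le> ennreal (dist (inverse (F n w)) (h w))"
        by (simp add: sph_dist_inv_le)
      also have "\<dots> < ennreal \<epsilon>"
        using elim(1) w by (intro ennreal_lessI assms(2)) auto
      finally show "sph_dist (sph_val (F n) w) (sph_inv (h w)) < ennreal \<epsilon>" .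
    qed
  qed
qed

lemma finite_conv_tendsto:
  "finite_conv F X h \<Longrightarrow> w \<in> X \<Longrightarrow> (\<lambda>n. F n w) \<longlonglongrightarrow> h w"
  unfolding finite_conv_def by (auto intro: tendsto_uniform_limitI)

lemma inverse_conv_tendsto:
  "inverse_conv F X h \<Longrightarrow> w \<in> X \<Longrightarrow> (\<lambda>n. inverse (F n w)) \<longlonglongrightarrow> h w"
  unfolding inverse_conv_def using tendsto_uniform_limitI by fastforce

text \<open>Identity theorem: a limit that vanishes on an open part of the ball vanishes on the
  whole ball.\<close>

lemma inverse_conv_identically_zero:
  assumes "inverse_conv F (ball z \<rho>) h" "open X" "w \<in> X" "w \<in> ball z \<rho>" "\<And>v. v \<in> X \<Longrightarrow> h v = 0"
  shows "inverse_conv F (ball z \<rho>) (\<lambda>_. 0)"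
proof -
  have "h v = 0" if "v \<in> ball z \<rho>" for v
  proof (rule analytic_continuation_open[of "X \<inter> ball z \<rho>" "ball z \<rho>" h "\<lambda>_. 0"])
    show "h holomorphic_on ball z \<rho>" using assms by (simp add: inverse_conv_def)
  qed (use assms that in auto)
  then show ?thesis
    using assms(1) unfolding inverse_conv_def
    by (auto intro: uniform_limit_cong'[THEN iffD1, rotated -1])
qed

lemma open_inverse_conv_zero: "open {z. \<exists>\<rho>>0. inverse_conv F (ball z \<rho>) (\<lambda>_. 0)}" (is "open ?Z")
proof (subst open_subopen, rule ballI)
  fix z assume "z \<in> ?Z"
  then obtain \<rho> where \<rho>: "\<rho> > 0" "inverse_conv F (ball z \<rho>) (\<lambda>_. 0)" by blast
  have "w \<in> ?Z" if w: "w \<in> ball z \<rho>" for w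
  proof -
    have "ball w (\<rho> - dist z w) \<subseteq> ball z \<rho>"
      by (simp add: ball_subset_ball_iff dist_commute)
    then show ?thesis
      using w \<rho> by (auto intro!: exI[of _ "\<rho> - dist z w"] inverse_conv_mono[OF \<rho>(2)])
  qed
  then show "\<exists>T. open T \<and> z \<in> T \<and> T \<subseteq> ?Z"
    using \<rho> by (intro exI[of _ "ball z \<rho>"]) auto
qed

text \<open>The points where the limit is not locally infinite form an open set among the points of
  convergence. Near a finite limit infinity is impossible, and in the coordinate at infinity it
  would spread by the identity theorem.\<close>

lemma inverse_conv_zero_nearby:
  assumes "sph_conv_at F z" "\<nexists>\<rho>. \<rho> > 0 \<and> inverse_conv F (ball z \<rho>) (\<lambda>_. 0)"
  obtains \<rho> where "\<rho> > 0" "\<And>w r. \<lbrakk>w \<in> ball z \<rho>; 0 < r\<rbrakk> \<Longrightarrow> \<not> inverse_conv F (ball w r) (\<lambda>_. 0)"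
proof -
  obtain \<rho> h where \<rho>: "\<rho> > 0" and "finite_conv F (ball z \<rho>) h \<or> inverse_conv F (ball z \<rho>) h"
    using assms(1) unfolding sph_conv_at_def by blast
  then have "\<not> inverse_conv F (ball w r) (\<lambda>_. 0)" if w: "w \<in> ball z \<rho>" "0 < r" for w r
  proof (elim disjE)
    assume fin: "finite_conv F (ball z \<rho>) h"
    show ?thesis
    proof
      assume inv: "inverse_conv F (ball w r) (\<lambda>_. 0)"
      \<comment> \<open>This product tends to 0 by the two limits, yet equals 1 for large
        \<open>n\<close>, when \<open>F n w\<close> is neither a pole nor a zero.\<close>
      have "(\<lambda>n. F n w * inverse (F n w)) \<longlonglongrightarrow> h w * 0"
        using finite_conv_tendsto[OF fin w(1)] inverse_conv_tendsto[OF inv, of w] w(2)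
        by (intro tendsto_mult) auto
      moreover have "\<forall>\<^sub>F n in sequentially. \<forall>v\<in>ball z \<rho>. \<not> is_pole (F n) v"
        "\<forall>\<^sub>F n in sequentially. \<forall>v\<in>ball w r. is_pole (F n) v \<or> F n v \<noteq> 0"
        using fin inv by (auto simp: finite_conv_def inverse_conv_def)
      then have "\<forall>\<^sub>F n in sequentially. F n w * inverse (F n w) = 1"
      proof eventually_elim
        case (elim n)
        then have "F n w \<noteq> 0" using w by force
        then show ?case by simp
      qed
      then have "(\<lambda>n. F n w * inverse (F n w)) \<longlonglongrightarrow> 1"
        by (rule tendsto_eventually)
      ultimately show False
        using LIMSEQ_unique by fastforce
    qed
  next
    assume inv_h: "inverse_conv F (ball z \<rho>) h"
    show ?thesis
    proof
      assume inv: "inverse_conv F (ball w r) (\<lambda>_. 0)"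
      have "h v = 0" if "v \<in> ball w r \<inter> ball z \<rho>" for v
        using that LIMSEQ_unique[OF inverse_conv_tendsto[OF inv_h] inverse_conv_tendsto[OF inv]] by auto
      then have "inverse_conv F (ball z \<rho>) (\<lambda>_. 0)"
        by (intro inverse_conv_identically_zero[OF inv_h, of "ball w r \<inter> ball z \<rho>" w]) (use w in auto)
      then show False using assms(2) \<rho> by blast
    qed
  qed
  with \<rho> show thesis using that by blast
qed

text \<open>The dummy value 0 is the one prescribed for poles of the limit by \<open>nicely_meromorphic_on\<close>.\<close>

definition pointwise_lim :: "(nat \<Rightarrow> complex \<Rightarrow> complex) \<Rightarrow> complex \<Rightarrow> complex" where
  "pointwise_lim F z = (if convergent (\<lambda>n. F n z) then lim (\<lambda>n. F n z) else 0)"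

section \<open>Construction of the global limit function\<close>

lemma pointwise_lim_finite_conv:
  assumes "finite_conv F X h" "w \<in> X"
  shows "pointwise_lim F w = h w"
  using finite_conv_tendsto[OF assms] by (auto simp: pointwise_lim_def limI convergentI)

text \<open>If \<open>h w = 0\<close>, the claimed value is 0. Either the values diverge and the
  default applies, or they converge, and then only to 0, since a non-zero limit would give the
  inverses a non-zero limit.\<close>

lemma pointwise_lim_inverse_conv:
  assumes "inverse_conv F X h" "w \<in> X"
  shows "pointwise_lim F w = inverse (h w)"
proof (cases "h w = 0")
  case False
  then have "(\<lambda>n. inverse (inverse (F n w))) \<longlonglongrightarrow> inverse (h w)"
    by (intro tendsto_inverse inverse_conv_tendsto[OF assms])
  then show ?thesis by (auto simp: pointwise_lim_def limI convergentI)
next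
  case True
  have "lim (\<lambda>n. F n w) = 0" if "convergent (\<lambda>n. F n w)"
  proof (rule ccontr)
    assume ne: "lim (\<lambda>n. F n w) \<noteq> 0"
    have "(\<lambda>n. F n w) \<longlonglongrightarrow> lim (\<lambda>n. F n w)"
      using that by (simp add: convergent_LIMSEQ_iff)
    from LIMSEQ_unique[OF tendsto_inverse[OF this ne] inverse_conv_tendsto[OF assms]]
    show False using ne True by simp
  qed
  then show ?thesis using True by (simp add: pointwise_lim_def)
qed

lemma nicely_meromorphic_on_local:
  "f nicely_meromorphic_on A \<longleftrightarrow> (\<forall>z\<in>A. f nicely_meromorphic_on {z})"
  unfolding nicely_meromorphic_on_def by (subst meromorphic_on_meromorphic_at) auto

text \<open>As \<open>h\<close> is not identically zero, its zeros are isolated and become poles of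
  \<open>g\<close>. The value \<open>inverse 0 = 0\<close> is the one required by the normal
  form.\<close>

lemma sph_val_inverse_holomorphic:
  assumes h: "h holomorphic_on ball z \<rho>" and g: "\<And>w. w \<in> ball z \<rho> \<Longrightarrow> g w = inverse (h w)"
    and nonzero: "\<exists>v\<in>ball z \<rho>. h v \<noteq> 0" and w: "w \<in> ball z \<rho>"
  shows "g nicely_meromorphic_on {w}" "sph_val g w = sph_inv (h w)"
proof -
  have ev: "eventually (\<lambda>v. v \<in> ball z \<rho>) (at w)"
    using w by (intro eventually_at_in_open') auto
  have "g nicely_meromorphic_on {w} \<and> sph_val g w = sph_inv (h w)"
  proof (cases "h w = 0")
    case False
    have "continuous_on (ball z \<rho>) h" using h by (rule holomorphic_on_imp_continuous_on)
    then have op: "open (ball z \<rho> \<inter> h -` (- {0}))"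
      by (rule continuous_open_preimage) auto
    have "(\<lambda>v. inverse (h v)) holomorphic_on ball z \<rho> \<inter> h -` (- {0})"
      by (intro holomorphic_intros holomorphic_on_subset[OF h]) auto
    then have hol: "g holomorphic_on ball z \<rho> \<inter> h -` (- {0})"
      by (rule holomorphic_transform) (use g in auto)
    have "\<not> is_pole g w"
      using False w by (intro not_is_pole_holomorphic[OF op _ hol]) auto
    moreover have "g analytic_on {w}"
      using op hol w False unfolding analytic_at by blast
    ultimately show ?thesis
      using False g[OF w] by (simp add: sph_val_def sph_inv_def analytic_on_imp_nicely_meromorphic_on)
  next
    case True
    obtain v where "v \<in> ball z \<rho>" "h v \<noteq> 0" using nonzero by blast
    with isolated_zeros[OF h _ _ w True] obtain r where
      r: "0 < r" "\<And>u. u \<in> ball w r - {w} \<Longrightarrow> h u \<noteq> 0"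
      by (metis connected_ball open_ball)
    have "h \<midarrow>w\<rightarrow> h w"
      using h w holomorphic_on_imp_continuous_on continuous_on_eq_continuous_at
      by (metis isCont_def open_ball)
    moreover have "eventually (\<lambda>u. h u \<noteq> 0) (at w)"
      using r by (auto simp: eventually_at dist_commute intro!: exI[of _ r])
    ultimately have "filterlim h (at 0) (at w)"
      using True by (simp add: filterlim_at)
    then have "is_pole (\<lambda>u. inverse (h u)) w"
      unfolding is_pole_def by (rule filterlim_compose[OF filterlim_inverse_at_infinity])
    then have pole: "is_pole g w"
      by (rule is_pole_transform) (use ev g in \<open>auto elim: eventually_mono\<close>)
    have "h analytic_on {w}"
      using h w unfolding analytic_at by blast
    then have "(\<lambda>u. inverse (h u)) meromorphic_on {w}"
      by (intro meromorphic_intros analytic_on_imp_meromorphic_on)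
    moreover have "eventually (\<lambda>u. inverse (h u) = g u) (at w)"
      using ev g by (auto elim: eventually_mono)
    ultimately have "g meromorphic_on {w}"
      using meromorphic_on_cong[of "{w}" "\<lambda>u. inverse (h u)" g "{w}"] by auto
    then show ?thesis
      using pole True g[OF w] by (simp add: nicely_meromorphic_on_def sph_val_def sph_inv_def)
  qed
  then show "g nicely_meromorphic_on {w}" "sph_val g w = sph_inv (h w)" by auto
qed

text \<open>Being locally infinite is an open condition on the limit, and so is its negation; on a
  connected set one of them holds throughout. In the second case the local limits agree with the
  pointwise limit and hence with each other.\<close>

lemma sph_convergent_on_if_conv_at:
  assumes "open U" "connected U"
    and F: "\<And>n. F n nicely_meromorphic_on U"
    and conv: "\<And>z. z \<in> U \<Longrightarrow> sph_conv_at F z"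
  shows "sph_convergent_on U F"
proof -
  define Z where "Z = {z. \<exists>\<rho>>0. inverse_conv F (ball z \<rho>) (\<lambda>_. 0)}"
  have pole: "F n w = 0" if "w \<in> U" "is_pole (F n) w" for n w
    using is_pole_zero_at_nicely_mero[OF F] that by blast
  have "open (U - Z)"
  proof (subst open_subopen, rule ballI)
    fix z assume z: "z \<in> U - Z"
    then have nz: "\<nexists>\<rho>. \<rho> > 0 \<and> inverse_conv F (ball z \<rho>) (\<lambda>_. 0)" by (auto simp: Z_def)
    obtain \<rho> where "\<rho> > 0" "\<And>w r. \<lbrakk>w \<in> ball z \<rho>; 0 < r\<rbrakk> \<Longrightarrow> \<not> inverse_conv F (ball w r) (\<lambda>_. 0)"
      using inverse_conv_zero_nearby[OF conv nz] z by blast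
    then have "ball z \<rho> \<inter> Z = {}" by (auto simp: Z_def)
    then show "\<exists>T. open T \<and> z \<in> T \<and> T \<subseteq> U - Z"
      using \<open>\<rho> > 0\<close> \<open>open U\<close> z by (intro exI[of _ "ball z \<rho> \<inter> U"]) auto
  qed
  moreover have "open Z" unfolding Z_def by (rule open_inverse_conv_zero)
  ultimately have "U \<subseteq> Z \<or> U \<inter> Z = {}"
    using connectedD[OF \<open>connected U\<close>, of Z "U - Z"] by blast
  then show ?thesis
  proof
    assume "U \<subseteq> Z"
    have "sph_locally_uniform_limit U (\<lambda>n. sph_val (F n)) (\<lambda>_. None)"
      unfolding sph_locally_uniform_limit_def
    proof
      fix z assume "z \<in> U"
      then obtain \<rho> where \<rho>: "\<rho> > 0" "inverse_conv F (ball z \<rho>) (\<lambda>_. 0)"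
        using \<open>U \<subseteq> Z\<close> by (auto simp: Z_def)
      have "inverse_conv F (ball z \<rho> \<inter> U) (\<lambda>_. 0)"
        by (rule inverse_conv_mono[OF \<rho>(2)]) auto
      from inverse_conv_sph_dist[OF this _ pole]
      show "\<exists>r>0. \<forall>\<epsilon>>0. \<forall>\<^sub>F n in sequentially. \<forall>w\<in>ball z r \<inter> U. sph_dist (sph_val (F n) w) None < ennreal \<epsilon>"
        using \<rho>(1) by (intro exI[of _ \<rho>]) (auto simp: sph_inv_def)
    qed
    then show ?thesis unfolding sph_convergent_on_def by blast
  next
    assume disj: "U \<inter> Z = {}"
    define g where "g = pointwise_lim F"
    have loc: "g nicely_meromorphic_on {z} \<and> (\<exists>r>0. \<forall>\<epsilon>>0. \<forall>\<^sub>F n in sequentially.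
        \<forall>w\<in>ball z r \<inter> U. sph_dist (sph_val (F n) w) (sph_val g w) < ennreal \<epsilon>)" if z: "z \<in> U" for z
    proof -
      obtain \<rho> h where \<rho>: "\<rho> > 0" and "finite_conv F (ball z \<rho>) h \<or> inverse_conv F (ball z \<rho>) h"
        using conv[OF z] unfolding sph_conv_at_def by blast
      then show ?thesis
      proof (elim disjE)
        assume fin: "finite_conv F (ball z \<rho>) h"
        have gh: "g w = h w" if "w \<in> ball z \<rho>" for w
          using pointwise_lim_finite_conv[OF fin that] by (simp add: g_def)
        have "h holomorphic_on ball z \<rho>" using fin by (simp add: finite_conv_def)
        then have hol: "g holomorphic_on ball z \<rho>"
          by (rule holomorphic_transform) (simp add: gh)
        then have "g analytic_on {z}"
          using \<rho> unfolding analytic_at by (meson centre_in_ball open_ball)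
        moreover have "sph_val g w = Some (h w)" if "w \<in> ball z \<rho>" for w
          using not_is_pole_holomorphic[OF open_ball that hol] gh[OF that] by (simp add: sph_val_def)
        moreover note finite_conv_sph_dist[OF finite_conv_mono[OF fin, of "ball z \<rho> \<inter> U"]]
        ultimately show ?thesis
          using \<rho> analytic_on_imp_nicely_meromorphic_on by (auto intro!: exI[of _ \<rho>])
      next
        assume inv: "inverse_conv F (ball z \<rho>) h"
        have gh: "g w = inverse (h w)" if "w \<in> ball z \<rho>" for w
          using pointwise_lim_inverse_conv[OF inv that] by (simp add: g_def)
        have h: "h holomorphic_on ball z \<rho>" using inv by (simp add: inverse_conv_def)
        \<comment> \<open>Otherwise \<open>z\<close> would belong to \<open>Z\<close>, which
          \<open>U\<close> does not meet.\<close>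
        have "\<exists>v\<in>ball z \<rho>. h v \<noteq> 0"
        proof (rule ccontr)
          assume "\<not> (\<exists>v\<in>ball z \<rho>. h v \<noteq> 0)"
          then have "inverse_conv F (ball z \<rho>) (\<lambda>_. 0)"
            using \<rho> by (intro inverse_conv_identically_zero[OF inv open_ball[of z \<rho>], of z]) auto
          then show False using disj z \<rho> by (auto simp: Z_def)
        qed
        note g = sph_val_inverse_holomorphic[OF h gh this]
        have "g nicely_meromorphic_on {z}" using \<rho> by (intro g) auto
        moreover have "\<forall>\<^sub>F n in sequentially. \<forall>w\<in>ball z \<rho> \<inter> U.
            sph_dist (sph_val (F n) w) (sph_val g w) < ennreal \<epsilon>" if "0 < \<epsilon>" for \<epsilon>
        proof -
          have "inverse_conv F (ball z \<rho> \<inter> U) h"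
            by (rule inverse_conv_mono[OF inv]) auto
          then have "\<forall>\<^sub>F n in sequentially. \<forall>w\<in>ball z \<rho> \<inter> U.
              sph_dist (sph_val (F n) w) (sph_inv (h w)) < ennreal \<epsilon>"
            using that by (rule inverse_conv_sph_dist) (use pole in auto)
          then show ?thesis
            by (rule eventually_mono) (use g(2) in auto)
        qed
        ultimately show ?thesis
          using \<rho> by blast
      qed
    qed
    then have "g nicely_meromorphic_on U" by (subst nicely_meromorphic_on_local) blast
    moreover have "sph_locally_uniform_limit U (\<lambda>n. sph_val (F n)) (sph_val g)"
      unfolding sph_locally_uniform_limit_def using loc by blast
    ultimately show ?thesis unfolding sph_convergent_on_def by blast
  qed
qed

section \<open>Concentration of area\<close>

lemma sph_conv_at_subseq:
  assumes "strict_mono r" "sph_conv_at F z"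
  shows "sph_conv_at (F \<circ> r) z"
  using assms(2) eventually_subseq[OF assms(1)]
  unfolding sph_conv_at_def finite_conv_def inverse_conv_def uniform_limit_iff o_def
  by meson

text \<open>Diagonal sequences have the j-th property only on a tail; convergence is insensitive to
  the discarded initial terms.\<close>

lemma sph_conv_at_shift: "sph_conv_at (F \<circ> (+) k) z \<longleftrightarrow> sph_conv_at F z"
proof -
  have "eventually (\<lambda>n. P (k + n)) sequentially \<longleftrightarrow> eventually P sequentially" for P
    using eventually_sequentially_seg[of P k] by (simp add: add.commute)
  note this[of "\<lambda>n. \<forall>w\<in>_. \<not> is_pole (F n) w"] this[of "\<lambda>n. \<forall>w\<in>_. is_pole (F n) w \<or> F n w \<noteq> 0"]
    this[of "\<lambda>n. \<forall>w\<in>_. dist (F n w) (_ w) < _"] this[of "\<lambda>n. \<forall>w\<in>_. dist (inverse (F n w)) (_ w) < _"]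
  then show ?thesis
    unfolding sph_conv_at_def finite_conv_def inverse_conv_def uniform_limit_iff o_def by simp
qed

section \<open>A countable basis of balls and the additivity of area\<close>

lemma countable_ball_basis:
  obtains q :: "nat \<Rightarrow> complex" and \<rho> :: "nat \<Rightarrow> real" where
    "\<And>j. 0 < \<rho> j" "\<And>z \<epsilon>. 0 < \<epsilon> \<Longrightarrow> \<exists>j. z \<in> ball (q j) (\<rho> j) \<and> ball (q j) (\<rho> j) \<subseteq> ball z \<epsilon>"
proof -
  obtain X :: "complex set" where X: "countable X" "\<And>U. open U \<Longrightarrow> U \<noteq> {} \<Longrightarrow> \<exists>x\<in>X. x \<in> U"
    using countable_dense_setE by blast
  have "X \<noteq> {}" using X(2)[of UNIV] by auto
  define q where "q = (\<lambda>j. from_nat_into X (fst (prod_decode j)))"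
  define \<rho> where "\<rho> = (\<lambda>j. inverse (real (Suc (snd (prod_decode j)))))"
  have "\<exists>j. z \<in> ball (q j) (\<rho> j) \<and> ball (q j) (\<rho> j) \<subseteq> ball z \<epsilon>" if "0 < \<epsilon>" for z \<epsilon>
  proof -
    \<comment> \<open>Less than half of \<epsilon>, because the ball is centred at a nearby dense
      point \<open>x\<close> and not at \<open>z\<close>.\<close>
    obtain n where n: "inverse (real (Suc n)) < \<epsilon> / 2"
      using reals_Archimedean[of "\<epsilon> / 2"] \<open>0 < \<epsilon>\<close> by auto
    obtain x where x: "x \<in> X" "x \<in> ball z (inverse (real (Suc n)))"
      using X(2)[of "ball z (inverse (real (Suc n)))"] by auto
    obtain i where i: "from_nat_into X i = x"
      using from_nat_into_surj[OF X(1) x(1)] by blast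
    define j where "j = prod_encode (i, n)"
    have "q j = x" "\<rho> j = inverse (real (Suc n))"
      by (simp_all add: q_def \<rho>_def j_def i)
    moreover have "ball x (inverse (real (Suc n))) \<subseteq> ball z \<epsilon>"
    proof
      fix w assume "w \<in> ball x (inverse (real (Suc n)))"
      then show "w \<in> ball z \<epsilon>"
        using x(2) n dist_triangle[of z w x] by simp
    qed
    ultimately show ?thesis
      using x(2) by (intro exI[of _ j]) (simp add: dist_commute)
  qed
  moreover have "0 < \<rho> j" for j by (simp add: \<rho>_def)
  ultimately show thesis using that by blast
qed

lemma nonpole_area_le_sph_deriv:
  "nonpole_area f D \<le> (\<integral>\<^sup>+ z\<in>D. ennreal ((sph_deriv f z)\<^sup>2) \<partial>lborel)"
  unfolding nonpole_area_def
  by (rule nn_integral_mono) (auto simp: indicator_def sph_deriv_def)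

lemma sum_nonpole_area_le:
  assumes f: "f nicely_meromorphic_on D" and "open D" "finite T"
    and disj: "disjoint_family_on B T" and B: "\<And>t. t \<in> T \<Longrightarrow> open (B t) \<and> B t \<subseteq> D"
  shows "(\<Sum>t\<in>T. nonpole_area f (B t)) \<le> nonpole_area f D"
proof -
  let ?N = "{z\<in>D. \<not> is_pole f z}"
  define \<phi> where "\<phi> = (\<lambda>z. (norm (deriv f z) / (1 + (norm (f z))\<^sup>2))\<^sup>2)"
  \<comment> \<open>Extended by zero, the density is Borel on the whole plane, so that the area
    becomes a measure.\<close>
  define \<psi> where "\<psi> = (\<lambda>z. ennreal (indicator ?N z *\<^sub>R \<phi> z))"
  note N = nicely_meromorphic_nonpoles[OF f \<open>open D\<close>]
  have "continuous_on ?N (deriv f)" "continuous_on ?N f"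
    using N by (auto intro!: holomorphic_on_imp_continuous_on holomorphic_deriv)
  moreover have "1 + (norm (f z))\<^sup>2 \<noteq> 0" for z
    by (metis add_pos_nonneg less_numeral_extra(1,3) zero_le_power2)
  ultimately have "continuous_on ?N \<phi>"
    unfolding \<phi>_def by (intro continuous_on_power continuous_on_divide continuous_on_add
        continuous_on_norm continuous_on_const) auto
  then have "(\<lambda>z. indicator ?N z *\<^sub>R \<phi> z) \<in> borel_measurable borel"
    using N(1) by (intro borel_measurable_continuous_on_indicator) auto
  then have meas: "\<psi> \<in> borel_measurable lborel"
    unfolding \<psi>_def by measurable
  have eq: "nonpole_area f V = emeasure (density lborel \<psi>) V" if "V \<subseteq> D" "open V" for V
  proof -
    have "nonpole_area f V = (\<integral>\<^sup>+ z\<in>V. \<psi> z \<partial>lborel)"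
      unfolding nonpole_area_def using that
      by (intro nn_integral_cong) (auto simp: indicator_def \<psi>_def \<phi>_def)
    also have "\<dots> = emeasure (density lborel \<psi>) V"
      using meas that by (intro emeasure_density[symmetric]) auto
    finally show ?thesis .
  qed
  have "(\<Sum>t\<in>T. nonpole_area f (B t)) = (\<Sum>t\<in>T. emeasure (density lborel \<psi>) (B t))"
    using B by (intro sum.cong refl eq) auto
  also have "\<dots> = emeasure (density lborel \<psi>) (\<Union>t\<in>T. B t)"
    using B disj \<open>finite T\<close> by (intro sum_emeasure) auto
  also have "\<dots> \<le> emeasure (density lborel \<psi>) D"
    using B \<open>open D\<close> by (intro emeasure_mono) auto
  also have "\<dots> = nonpole_area f D"
    using \<open>open D\<close> by (intro eq[symmetric]) auto
  finally show ?thesis .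
qed

lemma disjoint_balls_around_finite_set:
  fixes T :: "'a::metric_space set"
  assumes "finite T" "open D" "T \<subseteq> D"
  obtains e where "\<And>t. t \<in> T \<Longrightarrow> 0 < e t" "\<And>t. t \<in> T \<Longrightarrow> ball t (e t) \<subseteq> D"
    "disjoint_family_on (\<lambda>t. ball t (e t)) T"
proof -
  have "\<exists>e. t \<in> T \<longrightarrow> 0 < e \<and> ball t e \<subseteq> D \<and> (\<forall>x\<in>T. x \<noteq> t \<longrightarrow> 2 * e \<le> dist t x)" for t
  proof (cases "t \<in> T")
    case True
    obtain d where d: "d > 0" "\<forall>x\<in>T. x \<noteq> t \<longrightarrow> d \<le> dist t x"
      using finite_set_avoid[OF assms(1)] by blast
    obtain e where e: "e > 0" "ball t e \<subseteq> D"
      using assms True by (meson openE subsetD)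
    have "ball t (min (d / 2) e) \<subseteq> D"
      using e(2) by (rule order_trans[rotated]) auto
    then show ?thesis
      using d e by (intro exI[of _ "min (d / 2) e"]) fastforce
  qed auto
  then obtain e where e: "\<And>t. t \<in> T \<Longrightarrow> 0 < e t \<and> ball t (e t) \<subseteq> D \<and> (\<forall>x\<in>T. x \<noteq> t \<longrightarrow> 2 * e t \<le> dist t x)"
    by metis
  have "ball s (e s) \<inter> ball t (e t) = {}" if "s \<in> T" "t \<in> T" "s \<noteq> t" for s t
  proof (rule ccontr)
    assume "ball s (e s) \<inter> ball t (e t) \<noteq> {}"
    then obtain w where "dist s w < e s" "dist t w < e t" by auto
    moreover have "2 * e s \<le> dist s t" "2 * e t \<le> dist t s"
      using e[of s] e[of t] that by auto
    ultimately show False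
      using dist_triangle2[of s t w] dist_commute[of s t] by linarith
  qed
  then show thesis
    using e by (intro that[of e]) (auto simp: disjoint_family_on_def)
qed

text \<open>Each point claims an area beyond \<open>pi * c\<close> in its own disjoint ball, for all
  large \<open>n\<close> at once. With more than \<open>C\<close> points and \<open>c\<close> close
  to 1, the sum would exceed the total.\<close>

lemma concentration_points_card_le:
  fixes F :: "nat \<Rightarrow> complex \<Rightarrow> complex"
  assumes "open D" "0 < C" and F: "\<And>n. F n nicely_meromorphic_on D"
    and area: "\<And>n. nonpole_area (F n) D \<le> ennreal (pi * C)"
    and "finite T" "T \<subseteq> D"
    and conc: "\<And>t \<epsilon>. \<lbrakk>t \<in> T; 0 < \<epsilon>; ball t \<epsilon> \<subseteq> D\<rbrakk> \<Longrightarrow> \<exists>B \<subseteq> ball t \<epsilon>. open B \<and>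
      (\<forall>c. 0 \<le> c \<and> c < 1 \<longrightarrow> (\<forall>\<^sub>F n in sequentially. ennreal (pi * c) < nonpole_area (F n) B))"
  shows "real (card T) \<le> C"
proof (rule ccontr)
  assume "\<not> real (card T) \<le> C"
  then have card: "C < real (card T)" by simp
  \<comment> \<open>The midpoint of \<open>C / card T\<close> and 1: below 1, but
    \<open>card T * c\<close> is still larger than \<open>C\<close>.\<close>
  define c where "c = (C / real (card T) + 1) / 2"
  have c: "0 \<le> c" "c < 1" "C < real (card T) * c"
    using card \<open>0 < C\<close> by (auto simp: c_def field_simps)
  obtain e where e: "\<And>t. t \<in> T \<Longrightarrow> 0 < e t" "\<And>t. t \<in> T \<Longrightarrow> ball t (e t) \<subseteq> D"
    "disjoint_family_on (\<lambda>t. ball t (e t)) T"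
    using disjoint_balls_around_finite_set[OF \<open>finite T\<close> \<open>open D\<close> \<open>T \<subseteq> D\<close>] by blast
  have "\<forall>t\<in>T. \<exists>B. B \<subseteq> ball t (e t) \<and> open B \<and>
      (\<forall>\<^sub>F n in sequentially. ennreal (pi * c) < nonpole_area (F n) B)"
    using conc e c by meson
  then obtain B where B: "\<And>t. t \<in> T \<Longrightarrow> B t \<subseteq> ball t (e t)" "\<And>t. t \<in> T \<Longrightarrow> open (B t)"
    "\<And>t. t \<in> T \<Longrightarrow> \<forall>\<^sub>F n in sequentially. ennreal (pi * c) < nonpole_area (F n) (B t)"
    by metis
  have "\<forall>\<^sub>F n in sequentially. \<forall>t\<in>T. ennreal (pi * c) < nonpole_area (F n) (B t)"
    using \<open>finite T\<close> B(3) by (simp add: eventually_ball_finite_distrib)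
  then obtain n where n: "\<And>t. t \<in> T \<Longrightarrow> ennreal (pi * c) < nonpole_area (F n) (B t)"
    using eventually_happens trivial_limit_sequentially by blast
  have disj: "disjoint_family_on B T"
    using e(3) B(1) unfolding disjoint_family_on_def by blast
  have "ennreal (pi * (real (card T) * c)) = ennreal (\<Sum>t\<in>T. pi * c)"
    by (simp add: mult.left_commute)
  also have "\<dots> = (\<Sum>t\<in>T. ennreal (pi * c))"
    using c by (intro sum_ennreal[symmetric]) auto
  also have "\<dots> \<le> (\<Sum>t\<in>T. nonpole_area (F n) (B t))"
    using n by (intro sum_mono less_imp_le)
  also have "\<dots> \<le> nonpole_area (F n) D"
    using B e(2) by (intro sum_nonpole_area_le F \<open>open D\<close> \<open>finite T\<close> disj) fast
  also have "\<dots> \<le> ennreal (pi * C)" by (rule area)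
  finally show False
    using c(3) \<open>0 < C\<close> by (simp add: ennreal_le_iff)
qed

section \<open>The diagonal subsequence and its exceptional set\<close>

theorem theorem4p3:
  fixes D :: "complex set" and C :: real and \<F> :: "(complex \<Rightarrow> complex) set"
  assumes "open D" and "connected D" and "D \<noteq> {}"
    and "C > 0"
    and "\<And>f. f \<in> \<F> \<Longrightarrow> f nicely_meromorphic_on D"
    and "\<And>f. f \<in> \<F> \<Longrightarrow>
           ennreal (1 / pi) * (\<integral>\<^sup>+ z\<in>D. ennreal ((sph_deriv f z)\<^sup>2) \<partial>lborel) \<le> ennreal C"
  shows "quasi_normal_of_order D \<F> C"
  unfolding quasi_normal_of_order_def
proof (intro allI impI)
  fix f :: "nat \<Rightarrow> complex \<Rightarrow> complex"
  assume "range f \<subseteq> \<F>"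
  then have f\<F>: "f n \<in> \<F>" for n by blast
  have mero: "f n nicely_meromorphic_on D" for n
    using assms(5) f\<F> by blast
  have area: "nonpole_area (f n) D \<le> ennreal (pi * C)" for n
  proof -
    let ?I = "\<integral>\<^sup>+ z\<in>D. ennreal ((sph_deriv (f n) z)\<^sup>2) \<partial>lborel"
    have "ennreal pi * ennreal (1 / pi) = 1"
      by (simp flip: ennreal_mult)
    then have "?I = ennreal pi * (ennreal (1 / pi) * ?I)"
      by (simp only: mult.assoc[symmetric] mult_1)
    also have "\<dots> \<le> ennreal pi * ennreal C"
      by (intro mult_left_mono assms(6) f\<F>) auto
    also have "\<dots> = ennreal (pi * C)"
      using \<open>C > 0\<close> by (simp flip: ennreal_mult)
    finally show ?thesis
      using nonpole_area_le_sph_deriv order_trans by blast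
  qed
  obtain q :: "nat \<Rightarrow> complex" and \<rho> where \<rho>: "\<And>j. 0 < \<rho> j"
    and basis: "\<And>z \<epsilon>. 0 < \<epsilon> \<Longrightarrow> \<exists>j. z \<in> ball (q j) (\<rho> j) \<and> ball (q j) (\<rho> j) \<subseteq> ball z \<epsilon>"
    by (rule countable_ball_basis) (rule that)
  define conv where "conv = (\<lambda>j s. \<forall>z\<in>ball (q j) (\<rho> j). sph_conv_at (f \<circ> s) z)"
  define conc where "conc = (\<lambda>j s. \<forall>c. 0 \<le> c \<and> c < 1 \<longrightarrow>
    (\<forall>\<^sub>F n in sequentially. ennreal (pi * c) < nonpole_area (f (s n)) (ball (q j) (\<rho> j))))"
  \<comment> \<open>The dichotomy for one basis ball: convergence at all of its points, or area
    eventually above every \<open>pi * c\<close> with \<open>c < 1\<close>.\<close>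
  define P where "P = (\<lambda>j s. ball (q j) (\<rho> j) \<subseteq> D \<longrightarrow> conv j s \<or> conc j s)"
  interpret subseqs P
  proof
    fix j and s :: "nat \<Rightarrow> nat"
    show "\<exists>r. strict_mono r \<and> P j (s \<circ> r)"
    proof (cases "ball (q j) (\<rho> j) \<subseteq> D \<and> \<not> conc j s")
      case False
      then show ?thesis
        by (intro exI[of _ id]) (auto simp: P_def strict_mono_def)
    next
      case True
      then obtain c where c: "0 \<le> c" "c < 1"
        "\<not> (\<forall>\<^sub>F n in sequentially. ennreal (pi * c) < nonpole_area (f (s n)) (ball (q j) (\<rho> j)))"
        unfolding conc_def by blast
      \<comment> \<open>Failure of concentration for this \<open>c\<close> means area at most
        \<open>pi * c\<close> for infinitely many indices.\<close>
      obtain r1 :: "nat \<Rightarrow> nat" where r1: "strict_mono r1"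
        "\<And>n. nonpole_area (f (s (r1 n))) (ball (q j) (\<rho> j)) \<le> ennreal (pi * c)"
        using not_eventually_sequentiallyD[OF c(3)] by (auto simp: not_less)
      have "(f \<circ> s \<circ> r1) n nicely_meromorphic_on ball (q j) (\<rho> j)" for n
        using mero True by (auto intro: nicely_meromorphic_on_subset)
      then obtain r2 where "strict_mono r2"
        "\<And>z. z \<in> ball (q j) (\<rho> j) \<Longrightarrow> sph_conv_at (f \<circ> s \<circ> r1 \<circ> r2) z"
        using small_area_subseq_convergent[OF c(1,2) \<rho>, of "f \<circ> s \<circ> r1" "q j" j] r1(2) by auto
      then show ?thesis
        using r1(1) by (intro exI[of _ "r1 \<circ> r2"]) (auto simp: P_def conv_def o_assoc strict_mono_o)
    qed
  qed
  define r where "r = diagseq"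
  have r: "strict_mono r" unfolding r_def by (rule subseq_diagseq)
  have Pr: "P j r" for j
  proof -
    \<comment> \<open>Both alternatives pass to subsequences, so the diagonal sequence satisfies
      \<open>P j\<close> on a tail; the shift is removed afterwards.\<close>
    have "P j (s \<circ> r')" if "strict_mono r'" "P j s" for r' s j
      using that sph_conv_at_subseq[OF that(1), of "f \<circ> s"] eventually_subseq[OF that(1)]
      unfolding P_def conv_def conc_def o_assoc o_def by meson
    then have "P j (r \<circ> (+) (Suc j))"
      unfolding r_def by (rule diagseq_holds)
    moreover have "conv j (r \<circ> (+) k) \<longleftrightarrow> conv j r" for k
      unfolding conv_def by (simp add: o_assoc sph_conv_at_shift)
    moreover have "conc j (r \<circ> (+) k) \<longleftrightarrow> conc j r" for k
    proof -
      have "eventually (\<lambda>n. Q (k + n)) sequentially \<longleftrightarrow> eventually Q sequentially" for Q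
        using eventually_sequentially_seg[of Q k] by (simp add: add.commute)
      from this[of "\<lambda>n. _ < nonpole_area (f (r n)) _"] show ?thesis
        unfolding conc_def by simp
    qed
    ultimately show ?thesis by (simp add: P_def)
  qed
  define S where "S = {z\<in>D. \<nexists>j. z \<in> ball (q j) (\<rho> j) \<and> ball (q j) (\<rho> j) \<subseteq> D \<and> conv j r}"
  \<comment> \<open>Stated for finite subsets because the finiteness of \<open>S\<close> is only
    deduced from this uniform bound.\<close>
  have card: "real (card T) \<le> C" if T: "T \<subseteq> S" "finite T" for T
  proof (rule concentration_points_card_le[where F = "f \<circ> r"])
    show "T \<subseteq> D" using T by (auto simp: S_def)
    fix t \<epsilon> assume t: "t \<in> T" "0 < (\<epsilon>::real)" "ball t \<epsilon> \<subseteq> D"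
    obtain j where j: "t \<in> ball (q j) (\<rho> j)" "ball (q j) (\<rho> j) \<subseteq> ball t \<epsilon>"
      using basis[OF t(2)] by blast
    \<comment> \<open>A basis ball in \<open>D\<close> on which convergence held would exclude
      \<open>t\<close> from \<open>S\<close>, so the other alternative of \<open>P\<close>
      remains.\<close>
    then have "\<not> conv j r" using t T unfolding S_def by blast
    then have "conc j r" using Pr[of j] j t by (auto simp: P_def)
    then show "\<exists>B \<subseteq> ball t \<epsilon>. open B \<and> (\<forall>c. 0 \<le> c \<and> c < 1 \<longrightarrow>
        (\<forall>\<^sub>F n in sequentially. ennreal (pi * c) < nonpole_area ((f \<circ> r) n) B))"
      using j(2) by (intro exI[of _ "ball (q j) (\<rho> j)"]) (simp add: conc_def)
  qed (use assms(1,4) mero area T in auto)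
  have "card T \<le> nat \<lfloor>C\<rfloor>" if "T \<subseteq> S" "finite T" for T
    using card[OF that] by (simp add: le_nat_floor)
  then have "finite S"
    using finite_if_finite_subsets_card_bdd by blast
  have "sph_convergent_on (D - S) (f \<circ> r)"
  proof (rule sph_convergent_on_if_conv_at)
    show "open (D - S)"
      using \<open>open D\<close> \<open>finite S\<close> by (intro open_Diff finite_imp_closed)
    show "connected (D - S)"
      using assms(1,2) \<open>finite S\<close> by (intro connected_open_delete_finite) auto
    show "(f \<circ> r) n nicely_meromorphic_on D - S" for n
      using mero by (auto intro: nicely_meromorphic_on_subset)
    show "sph_conv_at (f \<circ> r) z" if "z \<in> D - S" for z
      using that by (auto simp: S_def conv_def)
  qed
  moreover have "\<not> z islimpt S" for z
    using \<open>finite S\<close> by (rule islimpt_finite)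
  ultimately show "\<exists>r S. strict_mono r \<and> S \<subseteq> D \<and> (\<forall>z\<in>D. \<not> z islimpt S) \<and>
      finite S \<and> real (card S) \<le> C \<and> sph_convergent_on (D - S) (f \<circ> r)"
    using r \<open>finite S\<close> card[OF order_refl \<open>finite S\<close>] S_def
    by (intro exI[of _ r] exI[of _ S]) auto
qed

end
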